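(* Let $\Gamma\subset\mathbb{R}^n$ be a smooth closed curve parameterized by a smooth $2a$-periodic function $\boldsymbol{\rho}:\mathbb{R}\to\mathbb{R}^n$ (with $a>0$) that is regular ($\boldsymbol{\rho}'(x)\neq0$ for all $x$) and injective on $[-a,a)$, and let $\tau$ be a smooth $2a$-periodic function. Put $r(x):=|\boldsymbol{\rho}(0)-\boldsymbol{\rho}(x)|$ and consider the Laplace single-layer potential $$S[\tau](\boldsymbol{\rho}(0)):=\int_{-a}^a\big(-\log r(x)\big)\,\tau(x)\,|\boldsymbol{\rho}'(x)|\,\mathrm{d}x.$$ Let $K\ge0$ be an integer and let $w_0,\dots,w_K$ be the solution of the linear system $$\sum_{j=0}^K w_j\,j^{2k}=-\zeta'(-2k),\qquad k=0,1,\dots,K,$$ where $0^0:=1$ and $\zeta'$ is the derivative of the Riemann zeta function. Then, with $s(x):=-\log r(x)$ and $\tilde\tau(x):=\tau(x)\,|\boldsymbol{\rho}'(x)|$ (which is smooth), one has the locally corrected trapezoidal rule $$S[\tau](\boldsymbol{\rho}(0))=T_h^0[s\cdot\tilde\tau]-\tilde\tau(0)\,h\log\big(|\boldsymbol{\rho}'(0)|\,h\big)+h\sum_{j=0}^K w_j\big(\tilde\tau(jh)+\tilde\tau(-jh)\big)+O(h^{2K+2})$$ as $h\to0^+$.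
   Context: For a function $g$ on $[-a,a]$, possibly singular at $0$, the punctured trapezoidal rule is $$T_h^0[g]:=\sum_{\substack{n=-M\\ n\ne0}}^{M} g(nh)\,h,\qquad h=\frac{a}{M+\frac12},$$ where $M>0$ is an integer; the limit $h\to0^+$ means $M\to\infty$ (with $M\ge K$). $|\cdot|$ denotes the Euclidean norm on $\mathbb{R}^n$. *)

theory Defs
  imports "HOL-Complex_Analysis.Complex_Analysis" "HOL-Library.Landau_Symbols"
begin

text \<open>
  The Riemann zeta function: the analytic continuation to \<open>- {1}\<close> of the Dirichlet series.
  The value at the pole is set to \<open>0\<close> only so that the description determines a total function.
\<close>
definition riemann_zeta :: "complex \<Rightarrow> complex" where
  "riemann_zeta = (THE f. f holomorphic_on - {1} \<and>
     (\<forall>s. Re s > 1 \<longrightarrow> (\<lambda>n. 1 / of_nat (Suc n) powr s) sums f s) \<and> f 1 = 0)"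

definition nth_vderiv :: "nat \<Rightarrow> (real \<Rightarrow> 'a::real_normed_vector) \<Rightarrow> real \<Rightarrow> 'a" where
  "nth_vderiv k = ((\<lambda>g x. vector_derivative g (at x)) ^^ k)"

definition smooth :: "(real \<Rightarrow> 'a::real_normed_vector) \<Rightarrow> bool" where
  "smooth f \<longleftrightarrow> (\<forall>k x. nth_vderiv k f differentiable (at x))"

definition periodic_with :: "real \<Rightarrow> (real \<Rightarrow> 'a) \<Rightarrow> bool" where
  "periodic_with p f \<longleftrightarrow> (\<forall>x. f (x + p) = f x)"

definition speed :: "(real \<Rightarrow> 'a::real_normed_vector) \<Rightarrow> real \<Rightarrow> real" where
  "speed \<rho> x = norm (vector_derivative \<rho> (at x))"

definition regular_closed_curve :: "real \<Rightarrow> (real \<Rightarrow> 'a::real_normed_vector) \<Rightarrow> bool" where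
  "regular_closed_curve a \<rho> \<longleftrightarrow>
     smooth \<rho> \<and> periodic_with (2 * a) \<rho> \<and>
     (\<forall>x. vector_derivative \<rho> (at x) \<noteq> 0) \<and> inj_on \<rho> {-a..<a}"

text \<open>
  Evaluated at a point of the curve the integrand has a logarithmic singularity; there \<open>ln 0 = 0\<close>
  is used, on a null set.
\<close>
definition single_layer ::
  "real \<Rightarrow> (real \<Rightarrow> 'a::real_normed_vector) \<Rightarrow> (real \<Rightarrow> real) \<Rightarrow> 'a \<Rightarrow> real" where
  "single_layer a \<rho> \<tau> y =
     (LINT x:{-a..a}|lborel. - ln (norm (y - \<rho> x)) * \<tau> x * speed \<rho> x)"

definition mesh :: "real \<Rightarrow> nat \<Rightarrow> real" where
  "mesh a M = a / (real M + 1/2)"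

definition punctured_trapezoid :: "real \<Rightarrow> nat \<Rightarrow> (real \<Rightarrow> real) \<Rightarrow> real" where
  "punctured_trapezoid a M g =
     (\<Sum>n\<in>{- int M..int M} - {0}. g (of_int n * mesh a M) * mesh a M)"

end

theory Submission
  imports Defs
begin

text \<open>
  Near the target the integrand is \<open>- ln \<bar>x\<bar>\<close> times a smooth density plus a smooth function, because
  \<open>\<bar>\<rho>(0) - \<rho>(x)\<bar>\<^sup>2 = x\<^sup>2 u(x)\<close> with \<open>u\<close> smooth and positive.  Taylor expansion of the density
  writes the integrand as a combination of the functions \<open>- x\<^sup>m ln \<bar>x\<bar>\<close> and a remainder that is
  differentiable often enough.  The Euler--Maclaurin formula on cells centred at the nodes applies to all
  of them; its boundary terms at \<open>\<plusminus>a\<close> cancel in the sum since the integrand is periodic.  What is left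
  are the constants in the Euler--Maclaurin expansion of \<open>\<Sum> - n\<^sup>m ln n\<close>, which are \<open>\<zeta>'(-m)\<close>, since the
  same expansion of \<open>\<Sum> n\<^sup>-\<^sup>s\<close> converges locally uniformly to \<open>\<zeta>(s)\<close> and can be differentiated in
  \<open>s\<close>.  For odd \<open>m\<close> the two half axes cancel, for even \<open>m\<close> the weights \<open>w\<^sub>j\<close> remove the constant.
\<close>

section \<open>Euler--Maclaurin on centred cells\<close>

text \<open>Since (M + 1/2) h = a, the cells centred at the nodes tile [-a, a] exactly and the
  puncture removes precisely the cell about 0; hence the midpoint form of the expansion. The two
  logarithms of the rule have different origins. Scaling gives ln(n h) = ln n + ln h, and ln h
  multiplies a power sum with constant zeta(-m), which for even m is nonzero only at m = 0. The
  speed comes from the value at 0 of the smooth part, which the puncture omits. The constants left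
  at even m are 2 zeta'(-m) h^(m+1), while the nodes j h contribute 2 h^(m+1) times the m-th moment
  of the weights; after m = 0, 2, ..., 2K are cancelled, the next power is h^(2K+3). Two obstacles
  shape the proof. The zeta function is given by a description, so its continuation has to be
  constructed. And locally uniform convergence identifies the constants without a rate; the rate
  comes from a separate real estimate at s = -m, where the high derivatives carry no
  logarithm.\<close>

definition half_diff :: "nat \<Rightarrow> real" where
  "half_diff i = ((1/2) ^ i - (- 1/2) ^ i) / fact i"

text \<open>\<open>half_diff\<close> lists the Taylor coefficients of 2 sinh(t/2), and the recursion
  inverts that series: the generating function is t / (2 sinh(t/2)), so the values are B_j(1/2)/j!
  with Bernoulli polynomials B_j.\<close>

fun em_coeff :: "nat \<Rightarrow> real" where
  "em_coeff 0 = 1"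
| "em_coeff (Suc m) = - (\<Sum>j\<le>m. em_coeff j * half_diff (Suc (Suc m) - j))"

declare em_coeff.simps(2) [simp del]

lemma half_diff_0 [simp]: "half_diff 0 = 0"
  and half_diff_1 [simp]: "half_diff (Suc 0) = 1"
  and half_diff_even: "even i \<Longrightarrow> half_diff i = 0"
  by (auto simp: half_diff_def)

lemma em_coeff_convolution:
  "(\<Sum>j\<le>m. em_coeff j * half_diff (m - j)) = (if m = 1 then 1 else 0)"
proof (cases m)
  case (Suc k)
  have "(\<Sum>j\<le>Suc k. em_coeff j * half_diff (Suc k - j))
      = (\<Sum>j\<le>k. em_coeff j * half_diff (Suc k - j))"
    by simp
  also have "\<dots> = (if k = 0 then 1 else 0)"
  proof (cases k)
    case (Suc n)
    have "(\<Sum>j\<le>Suc n. em_coeff j * half_diff (Suc (Suc n) - j))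
        = (\<Sum>j\<le>n. em_coeff j * half_diff (Suc (Suc n) - j)) + em_coeff (Suc n)"
      by simp
    also have "\<dots> = 0"
      by (subst em_coeff.simps(2)) simp
    finally show ?thesis
      using Suc by simp
  qed simp
  finally show ?thesis
    using Suc by simp
qed simp

text \<open>The generating function is even. In the recursion every product has a zero factor: the
  coefficient for odd \<open>j\<close>, by induction, and \<open>half_diff\<close> for even
  \<open>j\<close>.\<close>

lemma em_coeff_odd: "odd m \<Longrightarrow> em_coeff m = 0"
proof (induction m rule: less_induct)
  case (less m)
  then obtain k where k: "m = Suc k" "even k"
    by (cases m) auto
  have "em_coeff j * half_diff (Suc (Suc k) - j) = 0" if "j \<le> k" for j
  proof (cases "odd j")
    case True
    then show ?thesis using less.IH[of j] that k by simp
  next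
    case False
    then show ?thesis using that k by (simp add: half_diff_even)
  qed
  then show ?case
    unfolding k(1) em_coeff.simps(2) neg_equal_0_iff_equal by (intro sum.neutral) auto
qed

text \<open>The factor 2 counts the Taylor remainders at the two ends of a cell.\<close>

definition em_const :: "nat \<Rightarrow> real" where
  "em_const q = (\<Sum>j\<le>q. 2 * \<bar>em_coeff j\<bar>)"

lemma em_const_nonneg [simp]: "em_const q \<ge> 0"
  by (simp add: em_const_def sum_nonneg)

text \<open>
  Taylor expansion about the midpoint turns \<open>\<Sum>\<^sub>j C\<^sub>j h\<^sup>j (G\<^sub>j(x + h/2) - G\<^sub>j(x - h/2))\<close> into a Cauchy
  product of \<open>C\<close> with \<open>half_diff\<close>, which collapses to \<open>h G\<^sub>1(x)\<close>.
\<close>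
lemma midpoint_cell_error:
  fixes G :: "nat \<Rightarrow> 'a::{real_normed_field,euclidean_space} \<Rightarrow> 'a" and h :: real
  assumes S: "convex S" "x \<in> S" "x + of_real (h/2) \<in> S" "x - of_real (h/2) \<in> S"
    and der: "\<And>j y. j \<le> q \<Longrightarrow> y \<in> S \<Longrightarrow> (G j has_field_derivative G (Suc j) y) (at y within S)"
    and B: "\<And>y. y \<in> S \<Longrightarrow> norm (G (Suc q) y) \<le> B"
    and q: "q \<ge> 1" and h: "h \<ge> 0"
  shows "norm (of_real h * G 1 x - (\<Sum>j\<le>q. of_real (em_coeff j * h ^ j) *
           (G j (x + of_real (h/2)) - G j (x - of_real (h/2))))) \<le> em_const q * B * h ^ Suc q"
proof -
  have B0: "B \<ge> 0"
    using B[OF S(2)] norm_ge_zero order_trans by blast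
  \<comment> \<open>The expansion of \<open>G j\<close> stops at order \<open>q - j\<close>: the
    weight \<open>h ^ j\<close> supplies the missing powers, so every \<open>j\<close> contributes
    at the common order \<open>h ^ Suc q\<close>.\<close>
  define E where "E = (\<lambda>j. G j (x + of_real (h/2)) - G j (x - of_real (h/2))
      - (\<Sum>i\<le>q-j. G (j+i) x * of_real (h ^ i * half_diff i)))"
  have E: "norm (E j) \<le> 2 * B * h ^ (Suc q - j)" if j: "j \<le> q" for j
  proof -
    have T: "norm (G j (x + of_real d) - (\<Sum>i\<le>q-j. G (j+i) x * of_real d ^ i / fact i))
        \<le> B * h ^ (Suc q - j)" if d: "x + of_real d \<in> S" "\<bar>d\<bar> = h/2" for d
    proof -
      have "norm (G (j+0) (x + of_real d) - (\<Sum>i\<le>q-j. G (j+i) x * (x + of_real d - x) ^ i / fact i))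
          \<le> B * norm (x + of_real d - x) ^ Suc (q - j) / fact (q - j)"
        by (rule field_Taylor[where f = "\<lambda>i. G (j+i)", OF S(1)]) (use der B S d j in auto)
      also have "\<dots> = B * (h/2) ^ Suc (q - j) / fact (q - j)"
        using d(2) by (simp only: add_diff_cancel_left' norm_of_real)
      also have "\<dots> \<le> B * (h/2) ^ Suc (q - j) / 1"
        by (rule divide_left_mono) (use B0 h fact_ge_1 in auto)
      also have "\<dots> \<le> B * h ^ Suc (q - j)"
        using B0 h by (auto intro!: mult_left_mono power_mono simp del: power_Suc)
      finally show ?thesis
        using j by (simp add: Suc_diff_le)
    qed
    have *: "(\<Sum>i\<le>q-j. G (j+i) x * of_real (h ^ i * half_diff i))
       = (\<Sum>i\<le>q-j. G (j+i) x * of_real (h/2) ^ i / fact i)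
         - (\<Sum>i\<le>q-j. G (j+i) x * of_real (-(h/2)) ^ i / fact i)"
      unfolding sum_subtractf[symmetric]
    proof (rule sum.cong[OF refl], goal_cases)
      case (1 i)
      have "(h/2) ^ i = h ^ i * (1/2) ^ i" "(-(h/2)) ^ i = h ^ i * (- 1/2) ^ i"
        by (simp_all only: power_mult_distrib[symmetric]) simp_all
      then have "h ^ i * half_diff i = (h/2) ^ i / fact i - (-(h/2)) ^ i / fact i"
        by (simp only: half_diff_def times_divide_eq_right right_diff_distrib diff_divide_distrib)
      then have "of_real (h ^ i * half_diff i) = (of_real ((h/2) ^ i / fact i - (-(h/2)) ^ i / fact i) :: 'a)"
        by (simp only:)
      also have "\<dots> = of_real (h/2) ^ i / fact i - of_real (-(h/2)) ^ i / fact i"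
        by (simp only: of_real_diff of_real_divide of_real_power of_real_fact)
      finally show ?case
        by (simp only: right_diff_distrib times_divide_eq_right)
    qed
    have "E j = (G j (x + of_real (h/2)) - (\<Sum>i\<le>q-j. G (j+i) x * of_real (h/2) ^ i / fact i))
       - (G j (x + of_real (-(h/2))) - (\<Sum>i\<le>q-j. G (j+i) x * of_real (-(h/2)) ^ i / fact i))"
      unfolding E_def * by simp
    also have "norm \<dots> \<le> B * h ^ (Suc q - j) + B * h ^ (Suc q - j)"
      by (rule order_trans[OF norm_triangle_ineq4 add_mono]; rule T) (use S h in auto)
    finally show ?thesis by simp
  qed
  have "(\<Sum>j\<le>q. of_real (em_coeff j * h ^ j) * (\<Sum>i\<le>q-j. G (j+i) x * of_real (h ^ i * half_diff i)))
      = (\<Sum>(j,i)\<in>{(j,i). j + i \<le> q}. of_real (em_coeff j * half_diff i) * (of_real h ^ (j+i) * G (j+i) x))"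
  proof -
    have "(\<Sum>j\<le>q. of_real (em_coeff j * h ^ j) * (\<Sum>i\<le>q-j. G (j+i) x * of_real (h ^ i * half_diff i)))
      = (\<Sum>j\<le>q. \<Sum>i\<le>q-j. of_real (em_coeff j * half_diff i) * (of_real h ^ (j+i) * G (j+i) x))"
      by (simp add: sum_distrib_left mult_ac power_add)
    also have "\<dots> = (\<Sum>(j,i)\<in>(SIGMA j:{..q}. {..q-j}). of_real (em_coeff j * half_diff i) * (of_real h ^ (j+i) * G (j+i) x))"
      by (subst sum.Sigma) auto
    also have "(SIGMA j:{..q}. {..q-j}) = {(j,i). j + i \<le> q}"
      by auto
    finally show ?thesis .
  qed
  also have "\<dots> = (\<Sum>m\<le>q. \<Sum>j\<le>m. of_real (em_coeff j * half_diff (m-j)) * (of_real h ^ m * G m x))"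
    by (subst sum.triangle_reindex_eq) simp
  also have "\<dots> = (\<Sum>m\<le>q. of_real (\<Sum>j\<le>m. em_coeff j * half_diff (m-j)) * (of_real h ^ m * G m x))"
    by (simp add: sum_distrib_right)
  also have "\<dots> = (\<Sum>m\<le>q. if m = 1 then of_real h * G 1 x else 0)"
    by (rule sum.cong) (auto simp: em_coeff_convolution)
  also have "\<dots> = of_real h * G 1 x"
    using q by simp
  finally have main: "(\<Sum>j\<le>q. of_real (em_coeff j * h ^ j) *
      (\<Sum>i\<le>q-j. G (j+i) x * of_real (h ^ i * half_diff i))) = of_real h * G 1 x" .
  have "of_real h * G 1 x - (\<Sum>j\<le>q. of_real (em_coeff j * h ^ j) *
           (G j (x + of_real (h/2)) - G j (x - of_real (h/2)))) =
        - (\<Sum>j\<le>q. of_real (em_coeff j * h ^ j) * E j)"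
    unfolding main[symmetric] E_def by (simp add: right_diff_distrib sum_subtractf)
  also have "norm \<dots> \<le> (\<Sum>j\<le>q. \<bar>em_coeff j * h ^ j\<bar> * (2 * B * h ^ (Suc q - j)))"
    unfolding norm_minus_cancel
    by (rule sum_norm_le) (use E in \<open>auto simp: norm_mult mult_left_mono simp del: of_real_mult\<close>)
  also have "\<dots> = em_const q * B * h ^ Suc q"
    unfolding em_const_def sum_distrib_right
    by (rule sum.cong) (auto simp: abs_mult h power_add[symmetric] mult_ac simp del: power_Suc)
  finally show ?thesis .
qed

section \<open>The zeta function\<close>

text \<open>
  For \<open>s \<noteq> 1\<close> the functions \<open>x \<mapsto> zcoeff j s * x powr (1 - s - j)\<close> are an antiderivative of \<open>x powr - s\<close>
  (\<open>j = 0\<close>), \<open>x powr - s\<close> itself (\<open>j = 1\<close>) and its successive derivatives; \<open>dzcoeff j\<close> is the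
  derivative of \<open>zcoeff j\<close> in \<open>s\<close>.
\<close>
fun zcoeff :: "nat \<Rightarrow> 'a::real_normed_field \<Rightarrow> 'a" where
  "zcoeff 0 s = 1 / (1 - s)"
| "zcoeff (Suc 0) s = 1"
| "zcoeff (Suc (Suc j)) s = zcoeff (Suc j) s * (1 - s - of_nat (Suc j))"

fun dzcoeff :: "nat \<Rightarrow> 'a::real_normed_field \<Rightarrow> 'a" where
  "dzcoeff 0 s = 1 / (1 - s)\<^sup>2"
| "dzcoeff (Suc j) s = dzcoeff j s * (1 - s - of_nat j) - zcoeff j s"

text \<open>Prescribing 1 at index 1 makes all later coefficients polynomials in \<open>s\<close>;
  the price is that the uniform recursion holds only off the pole.\<close>

lemma zcoeff_Suc: "s \<noteq> 1 \<Longrightarrow> zcoeff (Suc j) s = zcoeff j s * (1 - s - of_nat j)"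
  by (cases j) auto

lemma has_field_derivative_zcoeff:
  fixes s :: "'a::real_normed_field"
  shows "s \<noteq> 1 \<Longrightarrow> (zcoeff j has_field_derivative dzcoeff j s) (at s)"
proof (induction j)
  case 0
  have "((\<lambda>s. 1 / (1 - s)) has_field_derivative 1 / (1 - s)\<^sup>2) (at s)"
    using 0 by (auto intro!: derivative_eq_intros simp: power2_eq_square)
  moreover have "zcoeff 0 = (\<lambda>s::'a. 1 / (1 - s))" by (simp add: fun_eq_iff)
  ultimately show ?case by simp
next
  case (Suc j)
  have "((\<lambda>s. zcoeff j s * (1 - s - of_nat j)) has_field_derivative dzcoeff (Suc j) s) (at s)"
    using Suc by (auto intro!: derivative_eq_intros simp: algebra_simps)
  then show ?case
  proof (rule has_field_derivative_transform_within_open)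
    show "open (- {1 :: 'a})" by auto
  qed (use Suc in \<open>auto simp: zcoeff_Suc\<close>)
qed

lemma zcoeff_of_real: "zcoeff j (of_real s) = (of_real (zcoeff j s) :: 'a::real_normed_field)"
  by (induction j s rule: zcoeff.induct) auto

lemma dzcoeff_of_real: "dzcoeff j (of_real s) = (of_real (dzcoeff j s) :: 'a::real_normed_field)"
  by (induction j) (auto simp: zcoeff_of_real)

text \<open>From index 1 on nothing is divided by 1 - s, so the bound is uniform on a whole ball, up
  to the pole. This permits domains from which only the point 1 is removed.\<close>

lemma norm_zcoeff_bounded:
  fixes s :: "'a::real_normed_field"
  assumes "norm s \<le> B"
  shows "norm (zcoeff (Suc j) s) \<le> (\<Prod>i<j. 1 + B + real (Suc i))"
proof (induction j)
  case (Suc j)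
  have "norm (1 - s - of_nat (Suc j)) \<le> norm (1 - s) + norm (of_nat (Suc j) :: 'a)"
    by (rule norm_triangle_ineq4)
  also have "\<dots> \<le> norm (1::'a) + norm s + real (Suc j)"
    by (intro add_mono norm_triangle_ineq4) (simp add: norm_of_nat del: of_nat_Suc)
  also have "\<dots> \<le> 1 + B + real (Suc j)"
    using assms by simp
  finally have "norm (1 - s - of_nat (Suc j)) \<le> 1 + B + real (Suc j)" .
  then have "norm (zcoeff (Suc j) s) * norm (1 - s - of_nat (Suc j))
      \<le> (\<Prod>i<j. 1 + B + real (Suc i)) * (1 + B + real (Suc j))"
    using Suc order_trans[OF norm_ge_zero assms]
    by (intro mult_mono prod_nonneg) auto
  then show ?case by (simp add: norm_mult)
qed auto

definition zeta_bdry :: "nat \<Rightarrow> real \<Rightarrow> complex \<Rightarrow> complex" where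
  "zeta_bdry p x s = (\<Sum>j\<le>p. of_real (em_coeff j) * (zcoeff j s * of_real x powr (1 - s - of_nat j)))"

text \<open>M + 1/2 is the right end of the last summed cell. What is subtracted includes the
  growing part of the partial sum, so that a constant is left in the limit when Re s + p >
  1.\<close>

definition zeta_approx :: "nat \<Rightarrow> nat \<Rightarrow> complex \<Rightarrow> complex" where
  "zeta_approx p M s = (\<Sum>n<M. of_nat (Suc n) powr - s) - zeta_bdry p (real M + 1/2) s"

text \<open>One more summand changes the approximation by exactly the error of the unit cell centred
  at \<open>Suc M\<close>. The cell is a segment of the positive real axis inside the complex plane,
  away from the branch cut. A lower bound \<open>\<sigma>\<close> for Re s keeps the estimate
  uniform in \<open>s\<close>.\<close>

lemma zeta_approx_step:
  assumes p: "p \<ge> 1" and M: "M \<ge> 1" and s: "s \<noteq> 1" "Re s \<ge> \<sigma>" "\<sigma> + real p \<ge> 0"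
  shows "norm (zeta_approx p (Suc M) s - zeta_approx p M s)
     \<le> em_const p * (norm (zcoeff (Suc p) s) * real M powr - (\<sigma> + real p))"
proof -
  define G where "G = (\<lambda>j z. zcoeff j s * z powr (1 - s - of_nat j))"
  define S where "S = closed_segment (complex_of_real (real M + 1/2)) (complex_of_real (real M + 3/2))"
  have S: "\<exists>t. y = of_real t \<and> t \<ge> real M + 1/2" if "y \<in> S" for y
    using that unfolding S_def closed_segment_of_real by (auto simp: closed_segment_eq_real_ivl)
  have inS: "of_real t \<in> S" if "real M + 1/2 \<le> t" "t \<le> real M + 3/2" for t
    using that unfolding S_def closed_segment_of_real by (auto simp: closed_segment_eq_real_ivl)
  have der: "(G j has_field_derivative G (Suc j) y) (at y within S)" if y: "y \<in> S" for j y
  proof -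
    obtain t where t: "y = of_real t" "t \<ge> real M + 1/2" using S y by blast
    then have "y \<notin> \<real>\<^sub>\<le>\<^sub>0" by (simp add: complex_nonpos_Reals_iff)
    then have "(G j has_field_derivative zcoeff j s * ((1 - s - of_nat j) * y powr (1 - s - of_nat j - 1)))
       (at y)"
      unfolding G_def by (intro DERIV_cmult has_field_derivative_powr)
    then show ?thesis
      using s by (simp add: G_def zcoeff_Suc algebra_simps has_field_derivative_at_within)
  qed
  have B: "norm (G (Suc p) y) \<le> norm (zcoeff (Suc p) s) * real M powr - (\<sigma> + real p)" if y: "y \<in> S" for y
  proof -
    obtain t where t: "y = of_real t" "t \<ge> real M + 1/2" using S y by blast
    have "norm (y powr (1 - s - of_nat (Suc p))) = t powr (- (Re s + real p))"
      unfolding t(1) using t(2) by (subst norm_powr_real_powr) auto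
    also have "\<dots> \<le> t powr - (\<sigma> + real p)"
      using s M t by (intro powr_mono) auto
    also have "\<dots> \<le> real M powr - (\<sigma> + real p)"
      using s M t by (intro powr_mono2') auto
    finally show ?thesis
      by (simp add: G_def norm_mult mult_left_mono)
  qed
  have "norm (of_real 1 * G 1 (of_nat (Suc M)) - (\<Sum>j\<le>p. of_real (em_coeff j * 1 ^ j) *
           (G j (of_nat (Suc M) + of_real (1/2)) - G j (of_nat (Suc M) - of_real (1/2)))))
       \<le> em_const p * (norm (zcoeff (Suc p) s) * real M powr - (\<sigma> + real p)) * 1 ^ Suc p"
  proof (rule midpoint_cell_error[where S = S])
    show "convex S" unfolding S_def by (rule convex_closed_segment)
    show "of_nat (Suc M) \<in> S" "of_nat (Suc M) + complex_of_real (1/2) \<in> S" "of_nat (Suc M) - complex_of_real (1/2) \<in> S"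
      using inS[of "real (Suc M)"] inS[of "real (Suc M) + 1/2"] inS[of "real (Suc M) - 1/2"] by auto
  qed (use p der B in auto)
  moreover have "of_real 1 * G 1 (of_nat (Suc M)) - (\<Sum>j\<le>p. of_real (em_coeff j * 1 ^ j) *
           (G j (of_nat (Suc M) + of_real (1/2)) - G j (of_nat (Suc M) - of_real (1/2))))
     = zeta_approx p (Suc M) s - zeta_approx p M s"
  proof -
    have "of_nat (Suc M) + of_real (1/2) = complex_of_real (real (Suc M) + 1/2)"
      "of_nat (Suc M) - of_real (1/2) = complex_of_real (real M + 1/2)"
      by (simp_all add: complex_eq_iff)
    then show ?thesis
      by (simp only: G_def zeta_approx_def zeta_bdry_def) (simp add: right_diff_distrib sum_subtractf)
  qed
  ultimately show ?thesis by simp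
qed

section \<open>Uniform convergence and the analytic continuation\<close>

definition zeta_half_plane :: "real \<Rightarrow> real \<Rightarrow> complex set" where
  "zeta_half_plane \<sigma> B = {s. Re s > \<sigma>} \<inter> ball 0 B - {1}"

lemma open_zeta_half_plane: "open (zeta_half_plane \<sigma> B)"
  unfolding zeta_half_plane_def by (intro open_Int open_Diff open_halfspace_Re_gt) auto

lemma holomorphic_zcoeff: "1 \<notin> A \<Longrightarrow> zcoeff j holomorphic_on A"
  using has_field_derivative_zcoeff
  by (metis field_differentiable_at_within field_differentiable_def holomorphic_on_def)

lemma holomorphic_zeta_approx: "zeta_approx p M holomorphic_on zeta_half_plane \<sigma> B"
  unfolding zeta_approx_def zeta_bdry_def
  by (intro holomorphic_intros holomorphic_zcoeff) (auto simp: zeta_half_plane_def)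

text \<open>Weierstrass test for the telescoping series of increments, which are dominated by a
  power of \<open>M\<close> with exponent below -1.\<close>

lemma zeta_approx_uniform_limit:
  assumes "p \<ge> 1" "\<sigma> + real p > 1"
  obtains g where "uniform_limit (zeta_half_plane \<sigma> B) (zeta_approx p) g sequentially"
proof -
  define A where "A = zeta_half_plane \<sigma> B"
  define c where "c = em_const p * (\<Prod>i<p. 1 + B + real (Suc i))"
  have "norm (zeta_approx p (Suc M) s - zeta_approx p M s) \<le> c * real M powr - (\<sigma> + real p)"
    if "M \<ge> 1" "s \<in> A" for M s
  proof -
    have s: "s \<noteq> 1" "Re s \<ge> \<sigma>" "norm s \<le> B"
      using that by (auto simp: A_def zeta_half_plane_def)
    have "norm (zeta_approx p (Suc M) s - zeta_approx p M s)
       \<le> em_const p * (norm (zcoeff (Suc p) s) * real M powr - (\<sigma> + real p))"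
      using that s assms by (intro zeta_approx_step) auto
    also have "\<dots> \<le> c * real M powr - (\<sigma> + real p)"
      using norm_zcoeff_bounded[OF s(3), of p] unfolding c_def mult.assoc
      by (intro mult_left_mono mult_right_mono) auto
    finally show ?thesis .
  qed
  then have "uniform_limit A (\<lambda>n s. \<Sum>M<n. zeta_approx p (Suc M) s - zeta_approx p M s)
      (\<lambda>s. \<Sum>M. zeta_approx p (Suc M) s - zeta_approx p M s) sequentially"
    using assms summable_real_powr_iff[of "- (\<sigma> + real p)"]
    by (intro Weierstrass_m_test_ev[where M = "\<lambda>M. c * real M powr - (\<sigma> + real p)"])
       (auto simp: eventually_at_top_linorder intro!: exI[of _ 1])
  then have "uniform_limit A (\<lambda>n s. zeta_approx p n s - zeta_approx p 0 s)
      (\<lambda>s. \<Sum>M. zeta_approx p (Suc M) s - zeta_approx p M s) sequentially"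
    by (subst (asm) sum_lessThan_telescope)
  then have "uniform_limit A (\<lambda>n s. (zeta_approx p n s - zeta_approx p 0 s) + zeta_approx p 0 s)
      (\<lambda>s. (\<Sum>M. zeta_approx p (Suc M) s - zeta_approx p M s) + zeta_approx p 0 s) sequentially"
    by (intro uniform_limit_add uniform_limit_const)
  then show ?thesis
    by (intro that) (simp add: A_def)
qed

lemma half_shift_powr_tendsto:
  assumes "Re c < 0"
  shows "(\<lambda>M. complex_of_real (real M + 1/2) powr c) \<longlonglongrightarrow> 0"
proof -
  have "filterlim (\<lambda>M. real M + 1/2) at_top sequentially"
    by (rule filterlim_at_top_mono[OF filterlim_real_sequentially]) auto
  with assms have "(\<lambda>M. (real M + 1/2) powr Re c) \<longlonglongrightarrow> 0"
    by (rule tendsto_neg_powr)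
  then have "(\<lambda>M. norm (complex_of_real (real M + 1/2) powr c)) \<longlonglongrightarrow> 0"
    by (subst norm_powr_real_powr) auto
  then show ?thesis by (rule tendsto_norm_zero_cancel)
qed

text \<open>The terms of index above \<open>p\<close> decay, so raising the order does not change
  the limit and the continuations obtained from different orders agree.\<close>

lemma zeta_bdry_extend:
  assumes "p \<le> p'" "Re s + real p > 1"
  shows "(\<lambda>M. zeta_bdry p' (real M + 1/2) s - zeta_bdry p (real M + 1/2) s) \<longlonglongrightarrow> 0"
proof -
  have tend: "(\<lambda>M. of_real (real M + 1/2) powr (1 - s - of_nat j)) \<longlonglongrightarrow> 0" if "j > p" for j
    using assms that by (intro half_shift_powr_tendsto) auto
  have "zeta_bdry p' x s - zeta_bdry p x s
     = (\<Sum>j\<in>{p<..p'}. of_real (em_coeff j) * (zcoeff j s * of_real x powr (1 - s - of_nat j)))" for x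
  proof -
    have "{..p'} = {..p} \<union> {p<..p'}" using assms by auto
    then show ?thesis
      unfolding zeta_bdry_def by (simp add: sum.union_disjoint ivl_disj_int)
  qed
  moreover have "(\<lambda>M. \<Sum>j\<in>{p<..p'}. of_real (em_coeff j) * (zcoeff j s * complex_of_real (real M + 1/2) powr (1 - s - of_nat j)))
     \<longlonglongrightarrow> (\<Sum>j\<in>{p<..p'}. of_real (em_coeff j) * (zcoeff j s * 0))"
    by (intro tendsto_intros tend) auto
  ultimately show ?thesis by simp
qed

text \<open>An order depending on \<open>s\<close> lets one formula cover the plane: Re s plus the
  order is at least 3. The value at 1 matches the normalisation in
  \<open>riemann_zeta\<close>.\<close>

definition zeta_limit :: "complex \<Rightarrow> complex" where
  "zeta_limit s = (if s = 1 then 0 else lim (\<lambda>M. zeta_approx (nat \<lceil>2 - Re s\<rceil> + 1) M s))"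

lemma zeta_approx_tendsto:
  assumes "p \<ge> 1" "Re s + real p > 1" "s \<noteq> 1"
  shows "(\<lambda>M. zeta_approx p M s) \<longlonglongrightarrow> zeta_limit s"
proof -
  have conv: "convergent (\<lambda>M. zeta_approx p M s)" if p: "p \<ge> 1" "Re s + real p > 1" for p
  proof -
    define \<sigma> where "\<sigma> = (Re s + (1 - real p)) / 2"
    obtain g where "uniform_limit (zeta_half_plane \<sigma> (norm s + 1)) (zeta_approx p) g sequentially"
      using zeta_approx_uniform_limit[of p \<sigma> "norm s + 1"] p unfolding \<sigma>_def by (auto simp: field_simps)
    then have "(\<lambda>M. zeta_approx p M s) \<longlonglongrightarrow> g s"
      by (rule tendsto_uniform_limitI) (use p assms in \<open>auto simp: zeta_half_plane_def \<sigma>_def field_simps\<close>)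
    then show ?thesis by (auto simp: convergent_def)
  qed
  define q where "q = nat \<lceil>2 - Re s\<rceil> + 1"
  have q: "q \<ge> 1" "Re s + real q > 1"
    unfolding q_def by auto linarith
  have "(\<lambda>M. zeta_approx q M s) \<longlonglongrightarrow> zeta_limit s"
    using conv[OF q] assms unfolding zeta_limit_def q_def by (auto simp: convergent_LIMSEQ_iff)
  moreover have "(\<lambda>M. zeta_approx p M s - zeta_approx q M s) \<longlonglongrightarrow> 0"
  proof (cases "p \<le> q")
    case True
    from zeta_bdry_extend[OF this assms(2)] show ?thesis
      by (simp add: zeta_approx_def)
  next
    case False
    with zeta_bdry_extend[of q p s] q have "(\<lambda>M. zeta_bdry p (real M + 1/2) s - zeta_bdry q (real M + 1/2) s) \<longlonglongrightarrow> 0"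
      by auto
    from tendsto_minus[OF this] show ?thesis
      by (simp add: zeta_approx_def)
  qed
  ultimately show ?thesis
    using tendsto_add by fastforce
qed

lemma zeta_limit_uniform:
  assumes "p \<ge> 1" "\<sigma> + real p > 1"
  shows "uniform_limit (zeta_half_plane \<sigma> B) (zeta_approx p) zeta_limit sequentially"
proof -
  obtain g where g: "uniform_limit (zeta_half_plane \<sigma> B) (zeta_approx p) g sequentially"
    using zeta_approx_uniform_limit[OF assms] by blast
  have "g s = zeta_limit s" if "s \<in> zeta_half_plane \<sigma> B" for s
    using tendsto_uniform_limitI[OF g that] zeta_approx_tendsto[of p s] that assms
    by (auto simp: zeta_half_plane_def intro: LIMSEQ_unique)
  then show ?thesis
    using g by (metis (no_types, lifting) uniform_limit_cong')
qed

lemma in_zeta_half_plane: "\<epsilon> > 0 \<Longrightarrow> s \<noteq> 1 \<Longrightarrow> s \<in> zeta_half_plane (Re s - \<epsilon>) (norm s + 1)"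
  by (auto simp: zeta_half_plane_def)

text \<open>A locally uniform limit of holomorphic functions: one fixed order serves a half plane
  reaching one unit to the left of \<open>s\<close>.\<close>

lemma zeta_limit_holomorphic: "zeta_limit holomorphic_on - {1}"
proof -
  have "zeta_limit field_differentiable (at s)" if s: "s \<noteq> 1" for s
  proof -
    define p where "p = nat \<lceil>3 - Re s\<rceil> + 1"
    define A where "A = zeta_half_plane (Re s - 1) (norm s + 1)"
    have p: "p \<ge> 1" "Re s - 1 + real p > 1"
      unfolding p_def by simp linarith
    have sA: "s \<in> A" using s in_zeta_half_plane[of 1 s] by (simp add: A_def)
    have "zeta_limit holomorphic_on A"
    proof (rule holomorphic_uniform_sequence)
      show "zeta_approx p n holomorphic_on A" for n
        unfolding A_def by (rule holomorphic_zeta_approx)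
      show "\<exists>d>0. cball x d \<subseteq> A \<and> uniform_limit (cball x d) (zeta_approx p) zeta_limit sequentially" if "x \<in> A" for x
        using zeta_limit_uniform[OF p] open_zeta_half_plane that unfolding A_def
        by (meson open_contains_cball uniform_limit_on_subset)
    qed (simp add: A_def open_zeta_half_plane)
    then show ?thesis
      using sA A_def open_zeta_half_plane holomorphic_on_imp_differentiable_at by blast
  qed
  then show ?thesis
    by (simp add: holomorphic_on_def field_differentiable_at_within)
qed

lemma zeta_limit_sums:
  assumes "Re s > 1"
  shows "(\<lambda>n. 1 / of_nat (Suc n) powr s) sums zeta_limit s"
proof -
  have "(\<lambda>M. complex_of_real (real M + 1/2) powr (1 - s)) \<longlonglongrightarrow> 0"
    using assms by (intro half_shift_powr_tendsto) auto
  then have "(\<lambda>M. 1 / (1 - s) * of_real (real M + 1/2) powr (1 - s)) \<longlonglongrightarrow> 1 / (1 - s) * 0"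
    by (intro tendsto_intros)
  then have "(\<lambda>M. zeta_bdry 0 (real M + 1/2) s) \<longlonglongrightarrow> 0"
    by (simp add: zeta_bdry_def)
  moreover have "(\<lambda>M. zeta_bdry 1 (real M + 1/2) s - zeta_bdry 0 (real M + 1/2) s) \<longlonglongrightarrow> 0"
    using assms by (intro zeta_bdry_extend) auto
  ultimately have "(\<lambda>M. zeta_bdry 1 (real M + 1/2) s) \<longlonglongrightarrow> 0"
    using tendsto_add by fastforce
  moreover have "(\<lambda>M. zeta_approx 1 M s) \<longlonglongrightarrow> zeta_limit s"
    using assms by (intro zeta_approx_tendsto) auto
  ultimately have "(\<lambda>M. zeta_approx 1 M s + zeta_bdry 1 (real M + 1/2) s) \<longlonglongrightarrow> zeta_limit s"
    using tendsto_add by fastforce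
  then show ?thesis
    by (simp add: sums_def zeta_approx_def powr_minus_divide)
qed

text \<open>The construction gives existence for the description. Uniqueness is the identity theorem
  on the connected set \<open>- {1}\<close>, the value at 1 being fixed separately.\<close>

lemma riemann_zeta_eq: "riemann_zeta = zeta_limit"
  unfolding riemann_zeta_def
proof (rule the_equality)
  show "zeta_limit holomorphic_on - {1} \<and>
     (\<forall>s. Re s > 1 \<longrightarrow> (\<lambda>n. 1 / of_nat (Suc n) powr s) sums zeta_limit s) \<and> zeta_limit 1 = 0"
    using zeta_limit_holomorphic zeta_limit_sums by (simp add: zeta_limit_def)
next
  fix f :: "complex \<Rightarrow> complex"
  assume f: "f holomorphic_on - {1} \<and>
     (\<forall>s. Re s > 1 \<longrightarrow> (\<lambda>n. 1 / of_nat (Suc n) powr s) sums f s) \<and> f 1 = 0"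
  have "f s = zeta_limit s" if "s \<noteq> 1" for s
  proof (rule analytic_continuation_open[where f = f and g = zeta_limit and z = s and s = "{s. Re s > 1}" and s' = "- {1}"])
    show "open {s. Re s > 1}" by (rule open_halfspace_Re_gt)
    have "(2::complex) \<in> {s. Re s > 1}" by simp
    then show "{s. Re s > 1} \<noteq> {}" by blast
    show "connected (- {1::complex})" by (rule connected_punctured_universe) simp
    show "f z = zeta_limit z" if "z \<in> {s. Re s > 1}" for z
      using that f zeta_limit_sums sums_unique2 by blast
  qed (use f zeta_limit_holomorphic that in auto)
  then show "f = zeta_limit"
    using f by (auto simp: fun_eq_iff zeta_limit_def)
qed

lemma deriv_zeta_approx_tendsto:
  assumes "p \<ge> 1" "Re s + real p > 1" "s \<noteq> 1"
  shows "(\<lambda>M. deriv (zeta_approx p M) s) \<longlonglongrightarrow> deriv riemann_zeta s"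
proof -
  \<comment> \<open>Half of the available slack, so that \<open>s\<close> lies inside a half plane
    on which convergence is still uniform.\<close>
  define \<epsilon> where "\<epsilon> = (Re s + real p - 1) / 2"
  have \<epsilon>: "\<epsilon> > 0" "Re s - \<epsilon> + real p > 1" using assms by (auto simp: \<epsilon>_def field_simps)
  show ?thesis unfolding riemann_zeta_eq
    by (rule deriv_complex_uniform_limit[OF zeta_limit_uniform[OF assms(1) \<epsilon>(2), of "norm s + 1"]])
       (use in_zeta_half_plane[OF \<epsilon>(1) assms(3)] in \<open>auto simp: open_zeta_half_plane holomorphic_zeta_approx\<close>)
qed

section \<open>Power sums with a logarithm\<close>

text \<open>At s = -m the factor 1 - s - j vanishes for j = m + 1: the derivatives of x^m beyond the
  m-th are zero.\<close>

lemma zcoeff_neg_nat_eq_0: "j \<ge> m + 2 \<Longrightarrow> zcoeff j (- real m) = 0"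
proof (induction j)
  case (Suc j)
  show ?case
  proof (cases "j = m + 1")
    case False
    with Suc show ?thesis by (simp add: zcoeff_Suc)
  qed simp
qed auto

lemma dzcoeff_1: "s \<noteq> 1 \<Longrightarrow> dzcoeff (Suc 0) s = 0"
  using nonzero_divide_mult_cancel_right[of "1 - s" "1 - s"] by (simp add: power2_eq_square)

text \<open>The case s = -m of the powers above; \<open>log_tower\<close> is the corresponding
  derivative in \<open>s\<close>. Integer exponents give both a meaning on the negative half axis,
  where the boundary terms at \<open>- a\<close> are evaluated.\<close>

definition pow_tower :: "nat \<Rightarrow> nat \<Rightarrow> real \<Rightarrow> real" where
  "pow_tower m j x = zcoeff j (- real m) * x powi (int m + 1 - int j)"

text \<open>Isabelle's \<open>ln\<close> is even on the reals, so \<open>ln x\<close> plays the role of \<open>ln \<bar>x\<bar>\<close> throughout.\<close>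
definition log_tower :: "nat \<Rightarrow> nat \<Rightarrow> real \<Rightarrow> real" where
  "log_tower m j x = (dzcoeff j (- real m) - zcoeff j (- real m) * ln x) * x powi (int m + 1 - int j)"

lemma pow_tower_1: "pow_tower m (Suc 0) x = x ^ m"
  by (simp add: pow_tower_def)

lemma log_tower_1: "log_tower m (Suc 0) x = - ln x * x ^ m"
  unfolding log_tower_def by (subst dzcoeff_1) auto

lemma power_int_mult_neg1: "(- x) powi n = (-1) powi n * (x :: real) powi n"
  using power_int_mult_distrib[of "-1" x n] by simp

lemma pow_tower_minus: "pow_tower m j (- x) = (-1) powi (int m + 1 - int j) * pow_tower m j x"
  by (simp add: pow_tower_def power_int_mult_neg1[of x] mult_ac)

lemma log_tower_minus: "log_tower m j (- x) = (-1) powi (int m + 1 - int j) * log_tower m j x"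
  by (simp add: log_tower_def power_int_mult_neg1[of x] ln_minus mult_ac)

lemma log_tower_1_minus: "log_tower m (Suc 0) (- x) = (-1) ^ m * log_tower m (Suc 0) x"
  by (simp add: log_tower_1 ln_minus power_minus[of x])

text \<open>Only even \<open>j\<close> survive, and for these m + 1 - j has the parity of m +
  1.\<close>

lemma em_coeff_sign: "em_coeff j * (-1) powi (int m + 1 - int j) = - ((-1) ^ m) * em_coeff j"
  by (cases "odd j") (auto simp: em_coeff_odd power_int_minus_left)

lemma DERIV_ln_nonzero:
  assumes "x \<noteq> 0"
  shows "(ln has_real_derivative 1 / x) (at x)"
proof (cases "x > 0")
  case False
  with assms have "- x > 0" by linarith
  then have "((\<lambda>x. ln (- x)) has_real_derivative 1 / (- x) * - 1) (at x)"
    by (intro DERIV_chain2[OF DERIV_ln_divide]) (auto intro!: derivative_eq_intros)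
  then show ?thesis by (simp add: ln_minus)
next
  case True
  then show ?thesis by (rule DERIV_ln_divide)
qed

text \<open>The recursion of \<open>dzcoeff\<close> is the product rule: its summand
  \<open>- zcoeff j s\<close> is what differentiating the logarithm contributes.\<close>

lemma has_derivative_log_tower:
  assumes "x \<noteq> 0"
  shows "(log_tower m j has_real_derivative log_tower m (Suc j) x) (at x)"
proof -
  define k where "k = int m + 1 - int j"
  have D: "((\<lambda>x. (dzcoeff j (- real m) - zcoeff j (- real m) * ln x) * x powi k) has_real_derivative
     (dzcoeff j (- real m) - zcoeff j (- real m) * ln x) * (of_int k * x powi (k - 1))
       + - (zcoeff j (- real m) * (1 / x)) * x powi k) (at x)"
  proof -
    have "((\<lambda>x. dzcoeff j (- real m) - zcoeff j (- real m) * ln x) has_real_derivative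
        0 - zcoeff j (- real m) * (1 / x)) (at x)"
      by (intro DERIV_diff DERIV_const DERIV_cmult DERIV_ln_nonzero assms)
    moreover have "((\<lambda>x. x powi k) has_real_derivative of_int k * x powi (k - 1)) (at x)"
      using DERIV_power_int[of "\<lambda>x. x" 1 x UNIV k] assms by simp
    ultimately have "((\<lambda>x. (dzcoeff j (- real m) - zcoeff j (- real m) * ln x) * x powi k) has_real_derivative
       (0 - zcoeff j (- real m) * (1 / x)) * x powi k
         + of_int k * x powi (k - 1) * (dzcoeff j (- real m) - zcoeff j (- real m) * ln x)) (at x)"
      by (rule DERIV_mult)
    then show ?thesis
      by (simp only: diff_0 mult_minus_left add.commute mult.commute)
  qed
  have S: "log_tower m (Suc j) x =
     (dzcoeff j (- real m) * of_int k - zcoeff j (- real m) - zcoeff j (- real m) * of_int k * ln x) * x powi (k - 1)"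
  proof -
    have "1 - (- real m) - of_nat j = of_int k" "int m + 1 - int (Suc j) = k - 1"
      by (auto simp: k_def)
    then show ?thesis
      unfolding log_tower_def zcoeff_Suc[of "- real m", simplified] dzcoeff.simps(2)
      by (simp only:) simp
  qed
  have E: "(dzcoeff j (- real m) - zcoeff j (- real m) * ln x) * (of_int k * x powi (k - 1))
       + - (zcoeff j (- real m) * (1 / x)) * x powi k
     = (dzcoeff j (- real m) * of_int k - zcoeff j (- real m) - zcoeff j (- real m) * of_int k * ln x) * x powi (k - 1)"
  proof -
    have "x powi k = x * x powi (k - 1)"
      using assms by (simp add: power_int_diff)
    then have *: "(zcoeff j (- real m) * (1 / x)) * x powi k = zcoeff j (- real m) * x powi (k - 1)"
      using assms by simp
    show ?thesis
      unfolding mult_minus_left * by algebra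
  qed
  have "log_tower m j = (\<lambda>x. (dzcoeff j (- real m) - zcoeff j (- real m) * ln x) * x powi k)"
    by (simp add: fun_eq_iff log_tower_def k_def)
  then show ?thesis
    using D[unfolded E] unfolding S by (simp only:)
qed

text \<open>The point 0 is included: up to index m + 1 the exponents are nonnegative, afterwards the
  coefficients are zero. Cells may therefore straddle 0.\<close>

lemma has_derivative_pow_tower: "(pow_tower m j has_real_derivative pow_tower m (Suc j) x) (at x)"
proof (cases "j \<le> m")
  case True
  define k where "k = m - j"
  have k: "int m + 1 - int j = int (Suc k)" "int m + 1 - int (Suc j) = int k"
    "1 - (- real m) - of_nat j = real (Suc k)"
    using True by (auto simp: k_def)
  have "((\<lambda>x. zcoeff j (- real m) * x ^ Suc k) has_real_derivative
     zcoeff j (- real m) * (real (Suc k) * x ^ k)) (at x)"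
    using DERIV_cmult[OF DERIV_pow[of "Suc k" x]] by simp
  then show ?thesis
    unfolding pow_tower_def k(1,2) power_int_of_nat
    by (subst zcoeff_Suc) (auto simp only: k(3) mult.assoc)
next
  case False
  then have "pow_tower m (Suc j) x = 0" by (simp add: pow_tower_def zcoeff_neg_nat_eq_0)
  moreover have "pow_tower m j = (\<lambda>_. pow_tower m j 0)"
    using False by (cases "j = m + 1") (auto simp: pow_tower_def fun_eq_iff zcoeff_neg_nat_eq_0)
  ultimately show ?thesis by (metis DERIV_const)
qed

lemma pow_tower_eq_0: "j \<ge> m + 2 \<Longrightarrow> pow_tower m j x = 0"
  by (simp add: pow_tower_def zcoeff_neg_nat_eq_0)

text \<open>For p >= m + 1 this is B_(m+1)(x + 1/2)/(m + 1), with B the Bernoulli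
  polynomial.\<close>

definition power_sum_bdry :: "nat \<Rightarrow> nat \<Rightarrow> real \<Rightarrow> real" where
  "power_sum_bdry p m x = (\<Sum>j\<le>p. em_coeff j * pow_tower m j x)"

text \<open>Euler--Maclaurin is exact on polynomials: the derivative of index \<open>Suc p\<close>
  that bounds the remainder is zero.\<close>

lemma power_sum_bdry_diff:
  assumes "p \<ge> m + 1"
  shows "power_sum_bdry p m (x + 1/2) - power_sum_bdry p m (x - 1/2) = x ^ m"
proof -
  have "norm (of_real 1 * pow_tower m 1 x - (\<Sum>j\<le>p. of_real (em_coeff j * 1 ^ j) *
           (pow_tower m j (x + of_real (1/2)) - pow_tower m j (x - of_real (1/2))))) \<le> em_const p * 0 * 1 ^ Suc p"
    by (rule midpoint_cell_error[where S = UNIV])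
       (use assms has_derivative_pow_tower pow_tower_eq_0 in auto)
  then show ?thesis
    by (simp add: pow_tower_1 power_sum_bdry_def right_diff_distrib sum_subtractf)
qed

lemma power_sum_bdry_minus: "power_sum_bdry p m (- x) = - ((-1) ^ m) * power_sum_bdry p m x"
proof -
  have "em_coeff j * pow_tower m j (- x) = - ((-1) ^ m) * (em_coeff j * pow_tower m j x)" for j
    using em_coeff_sign[of j m] by (simp only: pow_tower_minus mult.assoc[symmetric])
  then show ?thesis
    unfolding power_sum_bdry_def sum_distrib_left by (intro sum.cong) auto
qed

lemma sum_powers_eq:
  assumes "p \<ge> m + 1"
  shows "(\<Sum>n<M. real (Suc n) ^ m) = power_sum_bdry p m (real M + 1/2) - power_sum_bdry p m (1/2)"
proof (induction M)
  case (Suc M)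
  show ?case
    using power_sum_bdry_diff[OF assms, of "real (Suc M)"] Suc by (simp add: algebra_simps)
qed simp

text \<open>For even \<open>m\<close> this is the evaluation of \<open>\<zeta>(-m)\<close>: it is \<open>-1/2\<close> for \<open>m = 0\<close> and \<open>0\<close> otherwise.\<close>
lemma power_sum_bdry_half:
  assumes "p \<ge> m + 1"
  shows "(1 + (-1) ^ m) * power_sum_bdry p m (1/2) = 0 ^ m"
  \<comment> \<open>The cell centred at 0 has the ends 1/2 and -1/2, and parity expresses one
    boundary value by the other.\<close>
  using power_sum_bdry_diff[OF assms, of 0] power_sum_bdry_minus[of p m "1/2"]
  by (simp add: algebra_simps)

section \<open>The constants zeta'(-m) and their rate of convergence\<close>

definition zeta_deriv_approx :: "nat \<Rightarrow> nat \<Rightarrow> nat \<Rightarrow> real" where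
  "zeta_deriv_approx p m M =
     (\<Sum>n<M. log_tower m (Suc 0) (real (Suc n))) - (\<Sum>j\<le>p. em_coeff j * log_tower m j (real M + 1/2))"

text \<open>Termwise differentiation in \<open>s\<close> at -m turns n^(-s) into -n^m ln n and each
  boundary term into a \<open>log_tower\<close>. The result is real, so the error estimates can stay
  on the real line.\<close>

lemma deriv_zeta_approx: "deriv (zeta_approx p M) (- of_nat m) = of_real (zeta_deriv_approx p m M)"
proof (rule DERIV_imp_deriv)
  define X where "X = real M + 1/2"
  have X: "X > 0" by (simp add: X_def)
  define s where "s = (- of_nat m :: complex)"
  have s: "s = of_real (- real m)" by (simp add: s_def)
  have s1: "s \<noteq> 1"
  proof
    assume "s = 1" then have "- real m = 1" unfolding s by (metis of_real_eq_1_iff)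
    then show False by simp
  qed
  have 1: "((\<lambda>s. of_nat (Suc n) powr - s) has_field_derivative of_real (log_tower m (Suc 0) (real (Suc n)))) (at s)" for n
  proof -
    have "((\<lambda>s. of_nat (Suc n) powr - s) has_field_derivative Ln (of_nat (Suc n)) * of_nat (Suc n) powr - s * - 1) (at s)"
      by (rule DERIV_chain2[OF has_field_derivative_powr_right], simp del: of_nat_Suc)
         (rule DERIV_minus[OF DERIV_ident])
    moreover have "complex_of_nat (Suc n) powr - s = of_real (real (Suc n) ^ m)"
      by (simp add: s_def del: of_nat_Suc)
    moreover have "Ln (of_nat (Suc n)) = of_real (ln (real (Suc n)))"
      using Ln_of_real[of "real (Suc n)"] by simp
    ultimately show ?thesis by (simp add: log_tower_1 del: of_nat_Suc)
  qed
  have 2: "((\<lambda>s. zcoeff j s * of_real X powr (1 - s - of_nat j)) has_field_derivative of_real (log_tower m j X)) (at s)" for j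
  proof -
    have "((\<lambda>s. of_real X powr (1 - s - of_nat j)) has_field_derivative
       Ln (of_real X) * of_real X powr (1 - s - of_nat j) * (0 - 1 - 0)) (at s)"
      using X by (intro DERIV_chain2[OF has_field_derivative_powr_right]
            DERIV_diff[OF DERIV_diff[OF DERIV_const DERIV_ident] DERIV_const]) simp
    from DERIV_mult[OF has_field_derivative_zcoeff[OF s1, of j] this]
    have "((\<lambda>s. zcoeff j s * of_real X powr (1 - s - of_nat j)) has_field_derivative
       dzcoeff j s * of_real X powr (1 - s - of_nat j)
         + - (Ln (of_real X) * of_real X powr (1 - s - of_nat j)) * zcoeff j s) (at s)"
      by simp
    moreover have "of_real X powr (1 - s - of_nat j) = of_real (X powi (int m + 1 - int j))"
    proof -
      have "1 - s - of_nat j = of_int (int m + 1 - int j)" by (simp add: s_def)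
      then show ?thesis using X complex_powr_of_int[of "of_real X" "int m + 1 - int j"]
        by (simp only: of_real_power_int) simp
    qed
    moreover have "Ln (of_real X) = of_real (ln X)" using X by (rule Ln_of_real)
    ultimately show ?thesis
      unfolding log_tower_def s zcoeff_of_real dzcoeff_of_real by (simp add: algebra_simps)
  qed
  have "((\<lambda>s. (\<Sum>n<M. of_nat (Suc n) powr - s) - (\<Sum>j\<le>p. of_real (em_coeff j) * (zcoeff j s * of_real X powr (1 - s - of_nat j))))
     has_field_derivative (\<Sum>n<M. of_real (log_tower m (Suc 0) (real (Suc n)))) -
       (\<Sum>j\<le>p. of_real (em_coeff j) * of_real (log_tower m j X))) (at s)"
    by (intro DERIV_diff DERIV_sum DERIV_cmult 1 2)
  then show "(zeta_approx p M has_field_derivative of_real (zeta_deriv_approx p m M)) (at (- of_nat m))"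
    unfolding zeta_approx_def zeta_bdry_def zeta_deriv_approx_def s_def X_def by (simp del: of_nat_Suc)
qed

lemma zeta_deriv_approx_tendsto:
  assumes "p \<ge> m + 2"
  shows "zeta_deriv_approx p m \<longlonglongrightarrow> Re (deriv riemann_zeta (- of_nat m))"
proof -
  have "(- of_nat m :: complex) \<noteq> 1"
  proof
    assume "(- of_nat m :: complex) = 1"
    then have "Re (- of_nat m) = 1" by (metis one_complex.sel(1))
    then show False by simp
  qed
  then have "(\<lambda>M. deriv (zeta_approx p M) (- of_nat m)) \<longlonglongrightarrow> deriv riemann_zeta (- of_nat m)"
    using assms by (intro deriv_zeta_approx_tendsto) auto
  then show ?thesis
    unfolding deriv_zeta_approx by (auto dest: tendsto_Re)
qed

text \<open>For p = q + m + 2 the coefficient of the logarithm in the derivative of index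
  \<open>Suc p\<close> is zero, which leaves a multiple of x^-(q+2).\<close>

lemma zeta_deriv_approx_step:
  assumes M: "M \<ge> 1" and p: "p = q + m + 2"
  shows "\<bar>zeta_deriv_approx p m (Suc M) - zeta_deriv_approx p m M\<bar>
    \<le> em_const p * \<bar>dzcoeff (Suc p) (- real m)\<bar> / real M ^ (q + 2)"
proof -
  define S where "S = {real M + 1/2..real M + 3/2}"
  define B where "B = \<bar>dzcoeff (Suc p) (- real m)\<bar> / real M ^ (q + 2)"
  have B: "norm (log_tower m (Suc p) y) \<le> B" if "y \<in> S" for y
  proof -
    have e: "int m + 1 - int (Suc p) = - int (q + 2)" and z: "zcoeff (Suc p) (- real m) = 0"
      using p zcoeff_neg_nat_eq_0[of m "Suc p"] by auto
    have "norm (log_tower m (Suc p) y) = \<bar>dzcoeff (Suc p) (- real m)\<bar> / \<bar>y ^ (q + 2)\<bar>"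
      unfolding log_tower_def e z power_int_minus power_int_of_nat
      by (simp only: mult_zero_left diff_zero real_norm_def abs_mult abs_inverse divide_inverse)
    also have "\<dots> \<le> B"
      unfolding B_def
    proof (rule frac_le)
      show "real M ^ (q + 2) \<le> \<bar>y ^ (q + 2)\<bar>"
        unfolding power_abs using that by (intro power_mono) (auto simp: S_def)
      show "0 < real M ^ (q + 2)" using M by (intro zero_less_power) simp
    qed auto
    finally show ?thesis .
  qed
  have "norm (of_real 1 * log_tower m 1 (real (Suc M)) - (\<Sum>j\<le>p. of_real (em_coeff j * 1 ^ j) *
           (log_tower m j (real (Suc M) + of_real (1/2)) - log_tower m j (real (Suc M) - of_real (1/2)))))
        \<le> em_const p * B * 1 ^ Suc p"
  proof (rule midpoint_cell_error[where S = S and G = "log_tower m" and h = 1])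
    show "(log_tower m j has_field_derivative log_tower m (Suc j) y) (at y within S)" if "y \<in> S" for j y
      by (rule has_field_derivative_at_within[OF has_derivative_log_tower]) (use that in \<open>auto simp: S_def\<close>)
    show "norm (log_tower m (Suc p) y) \<le> B" if "y \<in> S" for y
      using that by (rule B)
  qed (use p in \<open>auto simp: S_def\<close>)
  moreover have "of_real 1 * log_tower m 1 (real (Suc M)) - (\<Sum>j\<le>p. of_real (em_coeff j * 1 ^ j) *
           (log_tower m j (real (Suc M) + of_real (1/2)) - log_tower m j (real (Suc M) - of_real (1/2))))
     = zeta_deriv_approx p m (Suc M) - zeta_deriv_approx p m M"
  proof -
    have "real (Suc M) - of_real (1/2) = real M + 1/2" "real (Suc M) + of_real (1/2) = real (Suc M) + 1/2" by simp_all
    then show ?thesis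
      by (simp only: zeta_deriv_approx_def) (simp add: right_diff_distrib sum_subtractf)
  qed
  ultimately have "norm (zeta_deriv_approx p m (Suc M) - zeta_deriv_approx p m M) \<le> em_const p * B * 1 ^ Suc p"
    by (rule back_subst[where P = "\<lambda>x. norm x \<le> _"])
  then show ?thesis
    unfolding B_def power_one mult_1_right real_norm_def times_divide_eq_right .
qed

lemma zeta_deriv_approx_error:
  assumes p: "p = q + m + 2"
  obtains c where "\<And>M. M \<ge> 1 \<Longrightarrow>
    \<bar>zeta_deriv_approx p m M - Re (deriv riemann_zeta (- of_nat m))\<bar> \<le> c / real M ^ q"
proof
  define d where "d = zeta_deriv_approx p m"
  define c where "c = em_const p * \<bar>dzcoeff (Suc p) (- real m)\<bar>"
  have c: "c \<ge> 0" by (simp add: c_def)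
  \<comment> \<open>Of the q + 2 powers gained per step, q give the rate in \<open>M\<close> and the
    other two make the tail summable.\<close>
  have sm: "summable (\<lambda>n. 1 / real n ^ 2)"
    using inverse_power_summable[of 2, where 'a = real] by (simp add: divide_inverse)
  fix M :: nat assume M: "M \<ge> 1"
  have "\<bar>d (M + N) - d M\<bar> \<le> c / real M ^ q * (\<Sum>n. 1 / real n ^ 2)" for N
  proof -
    have "d (M + N) - d M = (\<Sum>n<N. d (Suc (M + n)) - d (M + n))"
      using sum_lessThan_telescope[of "\<lambda>n. d (M + n)" N] by simp
    also have "\<bar>\<dots>\<bar> \<le> (\<Sum>n<N. c / real M ^ q * (1 / real (M + n) ^ 2))"
    proof (rule order_trans[OF sum_abs sum_mono])
      fix n
      have "\<bar>d (Suc (M + n)) - d (M + n)\<bar> \<le> c / real (M + n) ^ (q + 2)"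
        using zeta_deriv_approx_step[of "M + n" p q m] M p by (simp add: d_def c_def)
      also have "\<dots> = c / real (M + n) ^ q * (1 / real (M + n) ^ 2)"
        by (simp add: power_add power2_eq_square)
      also have "\<dots> \<le> c / real M ^ q * (1 / real (M + n) ^ 2)"
        using M c by (intro mult_right_mono divide_left_mono power_mono) auto
      finally show "\<bar>d (Suc (M + n)) - d (M + n)\<bar> \<le> c / real M ^ q * (1 / real (M + n) ^ 2)" .
    qed
    also have "\<dots> = c / real M ^ q * (\<Sum>n\<in>{M..<M+N}. 1 / real n ^ 2)"
      unfolding sum_distrib_left[symmetric]
      by (rule arg_cong[where f = "(*) _"], rule sum.reindex_bij_witness[of _ "\<lambda>n. n - M" "\<lambda>n. M + n"]) auto
    also have "\<dots> \<le> c / real M ^ q * (\<Sum>n. 1 / real n ^ 2)"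
      using c by (intro mult_left_mono sum_le_suminf[OF sm]) auto
    finally show ?thesis .
  qed
  moreover have "(\<lambda>N. \<bar>d (M + N) - d M\<bar>) \<longlonglongrightarrow> \<bar>Re (deriv riemann_zeta (- of_nat m)) - d M\<bar>"
    using zeta_deriv_approx_tendsto[of m p] p unfolding d_def
    by (intro tendsto_intros LIMSEQ_ignore_initial_segment[where k = M, unfolded add.commute[of _ M]]) auto
  ultimately have "\<bar>Re (deriv riemann_zeta (- of_nat m)) - d M\<bar> \<le> c / real M ^ q * (\<Sum>n. 1 / real n ^ 2)"
    by (intro LIMSEQ_le_const2) auto
  then show "\<bar>zeta_deriv_approx p m M - Re (deriv riemann_zeta (- of_nat m))\<bar>
     \<le> (c * (\<Sum>n. 1 / real n ^ 2)) / real M ^ q"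
    by (simp add: d_def abs_minus_commute)
qed

section \<open>Passage from sums over integers to the scaled grid\<close>

lemma mesh_pos: "a > 0 \<Longrightarrow> mesh a M > 0"
  by (simp add: mesh_def add_pos_pos)

lemma mesh_le: "a > 0 \<Longrightarrow> mesh a M \<le> 2 * a"
  by (simp add: mesh_def field_simps)

lemma punctured_trapezoid_eq:
  "punctured_trapezoid a M g =
    mesh a M * (\<Sum>n<M. g (real (Suc n) * mesh a M) + g (- (real (Suc n) * mesh a M)))"
proof -
  define h where "h = mesh a M"
  have *: "{- int M..int M} - {0} = (\<lambda>n. int (Suc n)) ` {..<M} \<union> (\<lambda>n. - int (Suc n)) ` {..<M}"
  proof (intro equalityI subsetI)
    fix k assume k: "k \<in> {- int M..int M} - {0}"
    show "k \<in> (\<lambda>n. int (Suc n)) ` {..<M} \<union> (\<lambda>n. - int (Suc n)) ` {..<M}"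
    proof (cases "k > 0")
      case True
      then have "k = int (Suc (nat (k - 1)))" "nat (k - 1) < M" using k by auto
      then show ?thesis by blast
    next
      case False
      then have "k = - int (Suc (nat (- k - 1)))" "nat (- k - 1) < M" using k by auto
      then show ?thesis by blast
    qed
  qed auto
  have "punctured_trapezoid a M g = (\<Sum>n\<in>(\<lambda>n. int (Suc n)) ` {..<M}. g (of_int n * h) * h)
      + (\<Sum>n\<in>(\<lambda>n. - int (Suc n)) ` {..<M}. g (of_int n * h) * h)"
    unfolding punctured_trapezoid_def h_def[symmetric] * by (rule sum.union_disjoint) auto
  also have "\<dots> = (\<Sum>n<M. g (real (Suc n) * h) * h) + (\<Sum>n<M. g (- (real (Suc n) * h)) * h)"
    by (subst (1 2) sum.reindex) (auto simp: inj_on_def algebra_simps)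
  finally show ?thesis
    by (simp add: h_def sum.distrib sum_distrib_left mult_ac distrib_left)
qed

text \<open>Homogeneity together with ln(n h) = ln n + ln h reduces the grid sum to sums over
  integers. The last term is ln h times the constant of the power sum.\<close>

lemma punctured_trapezoid_log:
  fixes M :: nat
  assumes a: "a > 0" and p: "p \<ge> m + 1"
  defines "h \<equiv> mesh a M"
  shows "punctured_trapezoid a M (log_tower m (Suc 0)) =
    (\<Sum>j\<le>p. em_coeff j * h ^ j * (log_tower m j a - log_tower m j (- a)))
     + (1 + (-1) ^ m) * h ^ Suc m * zeta_deriv_approx p m M + 0 ^ m * h * ln h"
proof -
  \<comment> \<open>The end of the last cell before scaling; \<open>h * X = a\<close> holds
    exactly.\<close>
  define X where "X = real M + 1/2"
  have X: "X > 0" "h > 0" "h * X = a"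
    using a by (auto simp: X_def h_def mesh_def add_pos_pos)
  have scale: "h ^ Suc m * (log_tower m j X - ln h * pow_tower m j X) = h ^ j * log_tower m j a" for j
  proof -
    have "ln a = ln h + ln X" "a powi k = h powi k * X powi k" for k
      using X by (auto simp: ln_mult power_int_mult_distrib simp flip: X(3))
    then have "h ^ j * log_tower m j a = (dzcoeff j (- real m) - zcoeff j (- real m) * (ln h + ln X)) *
       (h ^ j * h powi (int m + 1 - int j)) * X powi (int m + 1 - int j)"
      unfolding log_tower_def by (simp add: mult_ac)
    also have "h ^ j * h powi (int m + 1 - int j) = h ^ Suc m"
      using X by (simp add: power_int_diff power_int_add flip: power_int_of_nat)
    finally show ?thesis
      by (simp add: log_tower_def pow_tower_def algebra_simps)
  qed
  have L: "log_tower m (Suc 0) (real (Suc n) * h) =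
       h ^ m * (log_tower m (Suc 0) (real (Suc n)) - ln h * real (Suc n) ^ m)" for n
    using X by (simp add: log_tower_1 ln_mult power_mult_distrib algebra_simps del: of_nat_Suc)
  have "punctured_trapezoid a M (log_tower m (Suc 0)) =
     h * (\<Sum>n<M. (1 + (-1) ^ m) * log_tower m (Suc 0) (real (Suc n) * h))"
    unfolding punctured_trapezoid_eq h_def[symmetric]
    by (simp add: log_tower_1_minus distrib_right del: of_nat_Suc)
  also have "\<dots> = (1 + (-1) ^ m) * h ^ Suc m *
     ((\<Sum>n<M. log_tower m (Suc 0) (real (Suc n))) - ln h * (\<Sum>n<M. real (Suc n) ^ m))"
    unfolding L by (simp add: sum_distrib_left sum_subtractf[symmetric] algebra_simps del: of_nat_Suc)
  also have "(\<Sum>n<M. log_tower m (Suc 0) (real (Suc n))) =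
      zeta_deriv_approx p m M + (\<Sum>j\<le>p. em_coeff j * log_tower m j X)"
    by (simp add: zeta_deriv_approx_def X_def)
  also have "(\<Sum>n<M. real (Suc n) ^ m) = (\<Sum>j\<le>p. em_coeff j * pow_tower m j X) - power_sum_bdry p m (1/2)"
    unfolding sum_powers_eq[OF p] X_def by (simp add: power_sum_bdry_def)
  also have "(1 + (-1) ^ m) * h ^ Suc m *
      (zeta_deriv_approx p m M + (\<Sum>j\<le>p. em_coeff j * log_tower m j X)
        - ln h * ((\<Sum>j\<le>p. em_coeff j * pow_tower m j X) - power_sum_bdry p m (1/2))) =
     (\<Sum>j\<le>p. em_coeff j * ((1 + (-1) ^ m) * (h ^ Suc m * (log_tower m j X - ln h * pow_tower m j X))))
     + (1 + (-1) ^ m) * h ^ Suc m * zeta_deriv_approx p m M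
     + h ^ Suc m * ln h * ((1 + (-1) ^ m) * power_sum_bdry p m (1/2))"
    by (simp add: algebra_simps sum_distrib_left sum_subtractf sum.distrib)
  also have "h ^ Suc m * ln h * ((1 + (-1) ^ m) * power_sum_bdry p m (1/2)) = 0 ^ m * h * ln h"
    unfolding power_sum_bdry_half[OF p] by (cases m) auto
  \<comment> \<open>The boundary terms of the two half axes, doubled or cancelled according to the
    parity of \<open>m\<close>, become differences between \<open>a\<close> and \<open>- a\<close>,
    the form to which periodicity applies.\<close>
  also have "(\<Sum>j\<le>p. em_coeff j * ((1 + (-1) ^ m) * (h ^ Suc m * (log_tower m j X - ln h * pow_tower m j X))))
     = (\<Sum>j\<le>p. em_coeff j * h ^ j * (log_tower m j a - log_tower m j (- a)))"
  proof (rule sum.cong[OF refl])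
    fix j
    have "em_coeff j * h ^ j * (log_tower m j a - log_tower m j (- a)) =
       h ^ j * log_tower m j a * (em_coeff j - em_coeff j * (-1) powi (int m + 1 - int j))"
      by (simp only: log_tower_minus) (simp add: algebra_simps)
    also have "\<dots> = em_coeff j * ((1 + (-1) ^ m) * (h ^ j * log_tower m j a))"
      unfolding em_coeff_sign by (simp add: algebra_simps)
    finally show "em_coeff j * ((1 + (-1) ^ m) * (h ^ Suc m * (log_tower m j X - ln h * pow_tower m j X)))
      = em_coeff j * h ^ j * (log_tower m j a - log_tower m j (- a))"
      by (simp only: scale)
  qed
  finally show ?thesis .
qed

section \<open>Differentiability classes on the line\<close>

text \<open>A graded class besides \<open>smooth\<close>, because x^m ln |x| has only finitely many
  derivatives at 0. Quantifying over the derivative lets closure properties go by induction without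
  formulas for higher derivatives. Derivatives are two-sided even at boundary points of
  \<open>S\<close>.\<close>

fun cont_diff :: "nat \<Rightarrow> real set \<Rightarrow> (real \<Rightarrow> 'a::real_normed_vector) \<Rightarrow> bool" where
  "cont_diff 0 S f \<longleftrightarrow> continuous_on S f"
| "cont_diff (Suc k) S f \<longleftrightarrow> (\<exists>f'. (\<forall>x\<in>S. (f has_vector_derivative f' x) (at x)) \<and> cont_diff k S f')"

lemma cont_diff_Suc_real:
  "cont_diff (Suc k) S (f :: real \<Rightarrow> real) \<longleftrightarrow>
    (\<exists>f'. (\<forall>x\<in>S. (f has_real_derivative f' x) (at x)) \<and> cont_diff k S f')"
  by (simp add: has_real_derivative_iff_has_vector_derivative)

lemma cont_diff_SucD: "cont_diff (Suc k) S f \<Longrightarrow> cont_diff k S f"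
proof (induction k arbitrary: f)
  case 0
  then show ?case
    by (auto intro!: continuous_at_imp_continuous_on dest: has_vector_derivative_continuous)
next
  case (Suc k)
  then show ?case by (metis cont_diff.simps(2))
qed

lemma cont_diff_le: "cont_diff k S f \<Longrightarrow> j \<le> k \<Longrightarrow> cont_diff j S f"
  by (induction k) (auto simp: le_Suc_eq dest: cont_diff_SucD simp del: cont_diff.simps)

lemma cont_diff_imp_continuous_on: "cont_diff k S f \<Longrightarrow> continuous_on S f"
  using cont_diff_le[of k S f 0] by simp

lemma cont_diff_subset: "cont_diff k S f \<Longrightarrow> T \<subseteq> S \<Longrightarrow> cont_diff k T f"
proof (induction k arbitrary: f)
  case (Suc k)
  then obtain f' where "\<forall>x\<in>S. (f has_vector_derivative f' x) (at x)" "cont_diff k S f'"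
    by auto
  then show ?case using Suc.IH[of f'] Suc.prems by auto
qed (auto intro: continuous_on_subset)

lemma cont_diff_const [simp]: "cont_diff k S (\<lambda>_. c)"
proof (induction k arbitrary: c)
  case (Suc k)
  then show ?case by (auto intro!: exI[of _ "\<lambda>_. 0"])
qed auto

lemma cont_diff_ident [simp]: "cont_diff k S (\<lambda>x. x)"
proof (cases k)
  case (Suc j)
  then show ?thesis by (auto intro!: exI[of _ "\<lambda>_. 1"])
qed auto

lemma cont_diff_add:
  "cont_diff k S f \<Longrightarrow> cont_diff k S g \<Longrightarrow> cont_diff k S (\<lambda>x. f x + g x)"
proof (induction k arbitrary: f g)
  case (Suc k)
  then obtain f' g' where "\<forall>x\<in>S. (f has_vector_derivative f' x) (at x)" "cont_diff k S f'"
     "\<forall>x\<in>S. (g has_vector_derivative g' x) (at x)" "cont_diff k S g'" by auto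
  then show ?case using Suc.IH[of f' g']
    by (auto intro!: exI[of _ "\<lambda>x. f' x + g' x"] has_vector_derivative_add)
qed (auto intro: continuous_on_add)

lemma cont_diff_bilinear:
  assumes "bounded_bilinear B"
  shows "cont_diff k S f \<Longrightarrow> cont_diff k S g \<Longrightarrow> cont_diff k S (\<lambda>x. B (f x) (g x))"
proof (induction k arbitrary: f g)
  case 0
  then show ?case using bounded_bilinear.continuous_on[OF assms] by auto
next
  case (Suc k)
  then obtain f' g' where *: "\<forall>x\<in>S. (f has_vector_derivative f' x) (at x)" "cont_diff k S f'"
     "\<forall>x\<in>S. (g has_vector_derivative g' x) (at x)" "cont_diff k S g'" by auto
  then have "cont_diff k S (\<lambda>x. B (f x) (g' x) + B (f' x) (g x))"
    by (intro cont_diff_add Suc.IH cont_diff_SucD[OF Suc.prems(1)] cont_diff_SucD[OF Suc.prems(2)])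
  then show ?case using * bounded_bilinear.has_vector_derivative[OF assms]
    by (auto intro!: exI[of _ "\<lambda>x. B (f x) (g' x) + B (f' x) (g x)"])
qed

lemmas cont_diff_mult = cont_diff_bilinear[OF bounded_bilinear_mult]
lemmas cont_diff_inner = cont_diff_bilinear[OF bounded_bilinear_inner]

lemma cont_diff_inverse:
  fixes f :: "real \<Rightarrow> real"
  shows "cont_diff k S f \<Longrightarrow> (\<And>x. x \<in> S \<Longrightarrow> f x \<noteq> 0) \<Longrightarrow> cont_diff k S (\<lambda>x. inverse (f x))"
proof (induction k arbitrary: f)
  case (Suc k)
  obtain f' where f': "\<forall>x\<in>S. (f has_real_derivative f' x) (at x)" "cont_diff k S f'"
    using Suc.prems(1) unfolding cont_diff_Suc_real by auto
  have i: "cont_diff k S (\<lambda>x. inverse (f x))"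
    by (rule Suc.IH[OF cont_diff_SucD[OF Suc.prems(1)] Suc.prems(2)])
  show ?case
    unfolding cont_diff_Suc_real
  proof (intro exI conjI ballI)
    show "cont_diff k S (\<lambda>x. (-1) * (inverse (f x) * f' x * inverse (f x)))"
      by (intro cont_diff_mult i f' cont_diff_const)
    show "((\<lambda>x. inverse (f x)) has_real_derivative (-1) * (inverse (f x) * f' x * inverse (f x))) (at x)"
      if "x \<in> S" for x
      using f' Suc.prems that by (auto intro!: derivative_eq_intros)
  qed
qed (auto intro: continuous_intros)

lemma cont_diff_ln:
  fixes f :: "real \<Rightarrow> real"
  assumes "cont_diff k S f" "\<And>x. x \<in> S \<Longrightarrow> f x \<noteq> 0"
  shows "cont_diff k S (\<lambda>x. ln (f x))"
proof (cases k)
  case 0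
  with assms show ?thesis by (auto intro: continuous_intros)
next
  case (Suc j)
  obtain f' where f': "\<forall>x\<in>S. (f has_real_derivative f' x) (at x)" "cont_diff j S f'"
    using assms(1) unfolding Suc cont_diff_Suc_real by auto
  show ?thesis unfolding Suc cont_diff_Suc_real
  proof (intro exI conjI ballI)
    show "cont_diff j S (\<lambda>x. inverse (f x) * f' x)"
      using assms(2) by (intro cont_diff_mult f' cont_diff_inverse cont_diff_SucD[OF assms(1)[unfolded Suc]])
    show "((\<lambda>x. ln (f x)) has_real_derivative inverse (f x) * f' x) (at x)" if "x \<in> S" for x
      using DERIV_chain2[where f = ln and g = f and x = x, OF DERIV_ln_nonzero] f'(1) assms(2) that
      by (simp add: divide_inverse)
  qed
qed

lemma cont_diff_sqrt:
  fixes f :: "real \<Rightarrow> real"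
  shows "cont_diff k S f \<Longrightarrow> (\<And>x. x \<in> S \<Longrightarrow> f x > 0) \<Longrightarrow> cont_diff k S (\<lambda>x. sqrt (f x))"
proof (induction k)
  case (Suc k)
  obtain f' where f': "\<forall>x\<in>S. (f has_real_derivative f' x) (at x)" "cont_diff k S f'"
    using Suc.prems(1) unfolding cont_diff_Suc_real by auto
  have i: "cont_diff k S (\<lambda>x. sqrt (f x))"
    by (rule Suc.IH[OF cont_diff_SucD[OF Suc.prems(1)] Suc.prems(2)])
  show ?case
    unfolding cont_diff_Suc_real
  proof (intro exI conjI ballI)
    show "cont_diff k S (\<lambda>x. inverse (sqrt (f x)) * (f' x * (1/2)))"
      using Suc.prems by (intro cont_diff_mult cont_diff_inverse i f' cont_diff_const) (metis Suc.prems(2) less_irrefl real_sqrt_eq_0_iff)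
    show "((\<lambda>x. sqrt (f x)) has_real_derivative inverse (sqrt (f x)) * (f' x * (1/2))) (at x)"
      if "x \<in> S" for x
      using f' Suc.prems(2)[OF that] that by (auto intro!: derivative_eq_intros)
  qed
qed (auto intro: continuous_intros)

section \<open>The factor x^m ln |x| at the origin\<close>

lemma continuous_power_ln:
  assumes "m > 0"
  shows "continuous_on UNIV (\<lambda>x::real. x ^ m * ln x)"
proof -
  have "isCont (\<lambda>x::real. x * ln x) x" for x
  proof (cases "x = 0")
    case True
    \<comment> \<open>With z = sqrt |y|, the inequality ln(1/z) <= 1/z - 1 bounds |ln |y|| by
      2/z.\<close>
    have bd: "\<bar>y * ln y\<bar> \<le> 2 * sqrt \<bar>y\<bar>" if "\<bar>y\<bar> < 1" for y :: real
    proof (cases "y = 0")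
      case False
      define z where "z = sqrt \<bar>y\<bar>"
      have z: "z > 0" "z < 1" "\<bar>y\<bar> = z * z" using False that by (auto simp: z_def)
      have "ln y = ln \<bar>y\<bar>" by (cases "y \<ge> 0") (simp_all only: ln_minus abs_of_nonneg abs_of_neg not_le)
      moreover have "ln \<bar>y\<bar> < 0" using that False by (intro ln_less_zero) auto
      ultimately have "\<bar>ln y\<bar> = - ln \<bar>y\<bar>" by linarith
      also have "\<dots> = 2 * ln (1 / z)" using z by (simp add: ln_mult ln_div)
      also have "\<dots> \<le> 2 * (1 / z - 1)" using z by (intro mult_left_mono ln_le_minus_one) auto
      also have "\<dots> \<le> 2 / z" using z by simp
      finally have "\<bar>y * ln y\<bar> \<le> (z * z) * (2 / z)"
        unfolding abs_mult z(3) using z by (intro mult_left_mono) auto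
      also have "\<dots> = 2 * sqrt \<bar>y\<bar>" unfolding z_def[symmetric] using z(1) by simp
      finally show ?thesis .
    qed simp
    have lim: "((\<lambda>y::real. 2 * sqrt \<bar>y\<bar>) \<longlongrightarrow> 2 * sqrt \<bar>0\<bar>) (at 0)"
      by (intro tendsto_intros)
    have "\<forall>\<^sub>F y::real in at 0. norm (y * ln y) \<le> 2 * sqrt \<bar>y\<bar>"
    proof (unfold eventually_at, intro exI conjI ballI impI)
      show "norm (y * ln y) \<le> 2 * sqrt \<bar>y\<bar>" if "y \<noteq> 0 \<and> dist y 0 < 1" for y :: real
        using bd[of y] that by simp
    qed simp
    then have "((\<lambda>y::real. y * ln y) \<longlongrightarrow> 0) (at 0)"
      by (rule Lim_null_comparison) (use lim in simp)
    then show ?thesis using True by (simp add: isCont_def)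
  next
    case False
    then show ?thesis
      using DERIV_isCont[OF DERIV_ln_nonzero[OF False]] by (intro continuous_intros)
  qed
  then have c: "continuous_on UNIV (\<lambda>x::real. x * ln x)"
    by (simp add: continuous_on_eq_continuous_at)
  have "continuous_on UNIV (\<lambda>x::real. x ^ (m - 1) * (x * ln x))"
    by (intro continuous_on_mult c continuous_intros)
  moreover have "x ^ (m - 1) * (x * ln x) = x ^ m * ln x" for x :: real
    using assms by (cases m) auto
  ultimately show ?thesis by (simp only:)
qed

text \<open>At 0 the difference quotient is y^m ln y itself, which tends to 0.\<close>

lemma DERIV_power_ln:
  assumes "m > 0"
  shows "((\<lambda>x::real. x ^ Suc m * ln x) has_real_derivative real (Suc m) * (x ^ m * ln x) + x ^ m) (at x)"
proof (cases "x = 0")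
  case True
  have "isCont (\<lambda>x::real. x ^ m * ln x) 0"
    using continuous_power_ln[OF assms] continuous_on_eq_continuous_at[of UNIV] by blast
  then have "((\<lambda>x::real. x ^ m * ln x) \<longlongrightarrow> 0) (at 0)"
    using assms by (simp add: isCont_def power_0_left)
  then show ?thesis
    unfolding has_field_derivative_iff True
    by (subst LIM_equal[where g = "\<lambda>y. y ^ m * ln y"]) (use assms in \<open>auto simp: power_0_left\<close>)
next
  case False
  have "((\<lambda>x. x ^ Suc m * ln x) has_real_derivative real (Suc m) * x ^ m * ln x + 1 / x * x ^ Suc m) (at x)"
    by (rule DERIV_mult[OF _ DERIV_ln_nonzero[OF False]]) (use DERIV_pow[of "Suc m" x UNIV] in simp)
  then show ?thesis using False by (simp add: mult_ac)
qed

lemma cont_diff_power: "cont_diff k S (\<lambda>x::real. x ^ m)"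
  by (induction m) (auto intro: cont_diff_mult simp del: cont_diff.simps)

lemma cont_diff_power_ln: "k < m \<Longrightarrow> cont_diff k UNIV (\<lambda>x::real. x ^ m * ln x)"
proof (induction k arbitrary: m)
  case 0
  then show ?case by (simp add: continuous_power_ln)
next
  case (Suc k)
  then obtain n where n: "m = Suc n" "k < n" by (cases m) auto
  have "cont_diff k UNIV (\<lambda>x::real. real (Suc n) * (x ^ n * ln x) + x ^ n)"
    by (intro cont_diff_add cont_diff_mult[OF cont_diff_const] Suc.IH n cont_diff_power)
  then show ?case
    unfolding cont_diff_Suc_real n(1) using DERIV_power_ln[of n] n(2)
    by (intro exI[of _ "\<lambda>x. real (Suc n) * (x ^ n * ln x) + x ^ n"] conjI ballI) simp_all
qed

lemma continuous_on_weighted_dilation: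
  fixes g :: "real \<Rightarrow> real"
  assumes "continuous_on UNIV g"
  shows "continuous_on A (\<lambda>t. t ^ i * g (t * x))" and "continuous_on B (\<lambda>(x, t). t ^ i * g (t * x))"
proof -
  have "continuous_on A (\<lambda>t. g (t * x))" "continuous_on B (\<lambda>p. g (snd p * fst p))"
    by (rule continuous_on_compose2[OF assms]; intro continuous_intros subset_UNIV)+
  then show "continuous_on A (\<lambda>t. t ^ i * g (t * x))" "continuous_on B (\<lambda>(x, t). t ^ i * g (t * x))"
    unfolding split_beta by (intro continuous_intros; simp)+
qed

text \<open>The weight \<open>t ^ i\<close> is there for the induction: each differentiation under
  the integral releases another factor \<open>t\<close>.\<close>

lemma cont_diff_average:
  fixes g :: "real \<Rightarrow> real"
  shows "cont_diff k UNIV g \<Longrightarrow> cont_diff k UNIV (\<lambda>x. integral (cbox 0 1) (\<lambda>t. t ^ i * g (t * x)))"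
proof (induction k arbitrary: g i)
  case 0
  then have "continuous_on (UNIV \<times> cbox 0 1) (\<lambda>(x, t). t ^ i * g (t * x))"
    by (intro continuous_on_weighted_dilation) simp
  then show ?case
    unfolding cont_diff.simps by (rule integral_continuous_on_param)
next
  case (Suc k)
  obtain g' where g': "\<And>x. (g has_real_derivative g' x) (at x)" "cont_diff k UNIV g'"
    using Suc.prems unfolding cont_diff_Suc_real by auto
  have cg: "continuous_on UNIV g" "continuous_on UNIV g'"
    using Suc.prems g'(2) cont_diff_imp_continuous_on by blast+
  have "((\<lambda>x. integral (cbox 0 1) (\<lambda>t. t ^ i * g (t * x))) has_real_derivative
      integral (cbox 0 1) (\<lambda>t. t ^ Suc i * g' (t * x))) (at x within UNIV)" for x
  proof (rule leibniz_rule_field_derivative)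
    show "((\<lambda>x. t ^ i * g (t * x)) has_real_derivative t ^ Suc i * g' (t * x)) (at x within UNIV)" for x t
    proof -
      have "((\<lambda>x. g (t * x)) has_real_derivative g' (t * x) * t) (at x)"
        by (rule DERIV_chain2[OF g'(1)]) (auto intro!: derivative_eq_intros)
      from DERIV_cmult[OF this, of "t ^ i"] show ?thesis by (simp add: mult_ac)
    qed
    show "(\<lambda>t. t ^ i * g (t * x)) integrable_on cbox 0 1" for x
      by (intro integrable_continuous continuous_on_weighted_dilation cg)
    show "continuous_on (UNIV \<times> cbox 0 1) (\<lambda>(x, t). t ^ Suc i * g' (t * x))"
      by (intro continuous_on_weighted_dilation cg)
  qed auto
  then show ?case
    unfolding cont_diff_Suc_real using Suc.IH[OF g'(2), of "Suc i"]
    by (intro exI[of _ "\<lambda>x. integral (cbox 0 1) (\<lambda>t. t ^ Suc i * g' (t * x))"] conjI ballI)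
qed

lemma cont_diff_deriv:
  fixes f :: "real \<Rightarrow> real"
  assumes "\<And>k. cont_diff k UNIV f"
  shows "(f has_real_derivative deriv f x) (at x)" "cont_diff k UNIV (deriv f)"
proof -
  have *: "(f has_real_derivative deriv f x) (at x) \<and> cont_diff k UNIV (deriv f)" for k x
  proof -
    obtain f' where f': "\<And>x. (f has_real_derivative f' x) (at x)" "cont_diff k UNIV f'"
      using assms[of "Suc k"] unfolding cont_diff_Suc_real by auto
    then have "deriv f = f'" using DERIV_imp_deriv by blast
    then show ?thesis using f' by auto
  qed
  from * show "(f has_real_derivative deriv f x) (at x)" "cont_diff k UNIV (deriv f)" by auto
qed

text \<open>Hadamard's lemma, with \<open>g x = \<integral>\<^sub>0\<^sup>1 f'(t x) dt\<close>.\<close>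
lemma smooth_quotient:
  fixes f :: "real \<Rightarrow> real"
  assumes "\<And>k. cont_diff k UNIV f"
  obtains g where "\<And>k. cont_diff k UNIV g" "\<And>x. f x = f 0 + x * g x"
proof
  define g where "g = (\<lambda>x. integral (cbox 0 1) (\<lambda>t. t ^ 0 * deriv f (t * x)))"
  show "cont_diff k UNIV g" for k
    unfolding g_def by (rule cont_diff_average) (rule cont_diff_deriv[OF assms])
  show "f x = f 0 + x * g x" for x
  proof -
    have "((\<lambda>t. x * deriv f (t * x)) has_integral (f (1 * x) - f (0 * x))) {0..1}"
    proof (rule fundamental_theorem_of_calculus)
      fix t :: real
      have "((\<lambda>t. f (t * x)) has_real_derivative deriv f (t * x) * x) (at t)"
        by (rule DERIV_chain2[OF cont_diff_deriv(1)[OF assms]]) (auto intro!: derivative_eq_intros)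
      then show "((\<lambda>t. f (t * x)) has_vector_derivative x * deriv f (t * x)) (at t within {0..1})"
        by (simp add: has_real_derivative_iff_has_vector_derivative mult.commute has_vector_derivative_at_within)
    qed simp
    then have "integral {0..1} (\<lambda>t. x * deriv f (t * x)) = f x - f 0"
      by (intro integral_unique) simp
    then show ?thesis by (simp add: g_def)
  qed
qed

text \<open>Hadamard's lemma iterated. The remainder is x^n times a function smooth at 0, so
  multiplying it by ln |x| leaves the regularity of x^n ln |x|.\<close>

lemma smooth_taylor:
  fixes f :: "real \<Rightarrow> real"
  assumes "\<And>k. cont_diff k UNIV f"
  shows "\<exists>\<alpha> g. (\<forall>k. cont_diff k UNIV g) \<and> (\<forall>x. f x = (\<Sum>m<n. \<alpha> m * x ^ m) + x ^ n * g x)"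
proof (induction n)
  case 0
  then show ?case using assms by (auto intro: exI[of _ f])
next
  case (Suc n)
  then obtain \<alpha> g where g: "\<And>k. cont_diff k UNIV g" "\<And>x. f x = (\<Sum>m<n. \<alpha> m * x ^ m) + x ^ n * g x"
    by blast
  obtain g' where g': "\<And>k. cont_diff k UNIV g'" "\<And>x. g x = g 0 + x * g' x"
    using smooth_quotient[OF g(1)] by blast
  have "f x = (\<Sum>m<Suc n. (\<alpha>(n := g 0)) m * x ^ m) + x ^ Suc n * g' x" for x
    using g(2)[of x] g'(2)[of x] by (simp add: algebra_simps)
  with g'(1) show ?case by blast
qed

section \<open>Smooth functions and explicit families of derivatives\<close>

lemma nth_vderiv_Suc: "nth_vderiv (Suc k) f = nth_vderiv k (\<lambda>x. vector_derivative f (at x))"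
  unfolding nth_vderiv_def funpow_Suc_right by simp

lemma smooth_imp_cont_diff: "smooth f \<Longrightarrow> cont_diff k UNIV f"
proof (induction k arbitrary: f)
  case 0
  then have "f differentiable (at x)" for x
    unfolding smooth_def by (metis funpow_0 nth_vderiv_def)
  then show ?case
    by (auto simp: continuous_on_eq_continuous_at intro: differentiable_imp_continuous_within)
next
  case (Suc k)
  then have "f differentiable (at x)" for x
    unfolding smooth_def by (metis funpow_0 nth_vderiv_def)
  moreover have "smooth (\<lambda>x. vector_derivative f (at x))"
    using Suc.prems unfolding smooth_def by (metis nth_vderiv_Suc)
  ultimately show ?case
    using Suc.IH by (auto simp: vector_derivative_works[symmetric] intro!: exI[of _ "\<lambda>x. vector_derivative f (at x)"])
qed

lemma cont_diff_imp_smooth: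
  assumes "\<And>k. cont_diff k UNIV f"
  shows "smooth f"
proof -
  have "nth_vderiv k f differentiable (at x)" if "cont_diff (Suc k) UNIV f" for k f x
    using that
  proof (induction k arbitrary: f)
    case 0
    then show ?case by (auto simp: nth_vderiv_def intro: differentiableI_vector)
  next
    case (Suc k)
    then obtain f' where f': "\<And>x. (f has_vector_derivative f' x) (at x)" "cont_diff (Suc k) UNIV f'"
      by (auto simp del: cont_diff.simps(1))
    then have "(\<lambda>x. vector_derivative f (at x)) = f'" using vector_derivative_at by blast
    then show ?case using Suc.IH[OF f'(2)] by (simp add: nth_vderiv_Suc)
  qed
  then show ?thesis using assms unfolding smooth_def by blast
qed

lemma cont_diff_tower:
  fixes f :: "real \<Rightarrow> real"
  shows "cont_diff q S f \<Longrightarrow> \<exists>D. D 0 = f \<and> (\<forall>j<q. \<forall>x\<in>S. (D j has_real_derivative D (Suc j) x) (at x)) \<and> continuous_on S (D q)"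
proof (induction q arbitrary: f)
  case 0
  then show ?case by (intro exI[of _ "\<lambda>_. f"]) auto
next
  case (Suc q)
  then obtain f' where f': "\<And>x. x \<in> S \<Longrightarrow> (f has_real_derivative f' x) (at x)" "cont_diff q S f'"
    unfolding cont_diff_Suc_real by blast
  from Suc.IH[OF f'(2)] obtain D where D: "D 0 = f'" "\<And>j x. j < q \<Longrightarrow> x \<in> S \<Longrightarrow> (D j has_real_derivative D (Suc j) x) (at x)"
    "continuous_on S (D q)" by blast
  define D' where "D' = (\<lambda>j. case j of 0 \<Rightarrow> f | Suc i \<Rightarrow> D i)"
  have "(D' j has_real_derivative D' (Suc j) x) (at x)" if "j < Suc q" "x \<in> S" for j x
    using that f' D by (cases j) (auto simp: D'_def)
  moreover have "D' 0 = f" "D' (Suc q) = D q" by (auto simp: D'_def)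
  ultimately show ?case using D(3) by (intro exI[of _ D'] conjI allI impI ballI) simp_all
qed

section \<open>The punctured trapezoidal rule and the chord length\<close>

lemma punctured_trapezoid_plus_center:
  "punctured_trapezoid a M g + mesh a M * g 0
     = mesh a M * (\<Sum>k<2 * M + 1. g ((real k - real M) * mesh a M))"
proof -
  have "punctured_trapezoid a M g + mesh a M * g 0 = (\<Sum>n\<in>insert 0 ({- int M..int M} - {0}). g (of_int n * mesh a M) * mesh a M)"
    unfolding punctured_trapezoid_def by (subst sum.insert) auto
  also have "insert 0 ({- int M..int M} - {0}) = {- int M..int M}" by auto
  also have "(\<Sum>n\<in>{- int M..int M}. g (of_int n * mesh a M) * mesh a M)
     = (\<Sum>k<2 * M + 1. g ((real k - real M) * mesh a M) * mesh a M)"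
    by (rule sum.reindex_bij_witness[of _ "\<lambda>k. int k - int M" "\<lambda>n. nat (n + int M)"]) auto
  finally show ?thesis unfolding sum_distrib_left by (simp only: mult.commute)
qed

text \<open>With the node 0 restored, 2M + 1 cells tile [-a, a] and the inner boundary terms
  telescope. Summing errors of order h^(q+1) over cells of total length 2a costs one power of
  h.\<close>

lemma punctured_trapezoid_smooth:
  fixes M :: nat
  assumes a: "a > 0" and q: "q \<ge> 1"
    and der: "\<And>j x. j \<le> q \<Longrightarrow> x \<in> {- a..a} \<Longrightarrow> (G j has_real_derivative G (Suc j) x) (at x within {- a..a})"
    and B: "\<And>x. x \<in> {- a..a} \<Longrightarrow> \<bar>G (Suc q) x\<bar> \<le> B"
  defines "h \<equiv> mesh a M"
  shows "\<bar>punctured_trapezoid a M (G 1) + h * G 1 0 - (\<Sum>j\<le>q. em_coeff j * h ^ j * (G j a - G j (- a)))\<bar>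
    \<le> em_const q * B * (2 * a) * h ^ q"
proof -
  define N where "N = 2 * M + 1"
  define x where "x = (\<lambda>k::nat. (real k - real M) * h)"
  define y where "y = (\<lambda>k::nat. - a + real k * h)"
  have h: "h > 0" "real N * h = 2 * a"
    using a by (auto simp: h_def mesh_pos N_def mesh_def field_simps)
  have hM: "(real M + 1/2) * h = a" by (simp add: h_def mesh_def)
  have xy: "x k + h/2 = y (Suc k)" "x k - h/2 = y k" for k
    using hM by (auto simp: x_def y_def algebra_simps)
  have y_bounds: "y k \<in> {- a..a}" if "k \<le> N" for k
  proof -
    have "real k * h \<le> real N * h" using that h by (intro mult_right_mono) auto
    then show ?thesis using h by (auto simp: y_def)
  qed
  have cell: "\<bar>h * G 1 (x k) - (\<Sum>j\<le>q. em_coeff j * h ^ j * (G j (y (Suc k)) - G j (y k)))\<bar>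
      \<le> em_const q * B * h ^ Suc q" if k: "k < N" for k
  proof -
    have sub: "{y k..y (Suc k)} \<subseteq> {- a..a}"
      using y_bounds[of k] y_bounds[of "Suc k"] k by auto
    have ord: "y k \<le> x k" "x k \<le> y (Suc k)" using h xy[of k, symmetric] by auto
    have "norm (of_real h * G 1 (x k) - (\<Sum>j\<le>q. of_real (em_coeff j * h ^ j) *
           (G j (x k + of_real (h/2)) - G j (x k - of_real (h/2))))) \<le> em_const q * B * h ^ Suc q"
    proof (rule midpoint_cell_error[where S = "{y k..y (Suc k)}" and G = G and h = h and x = "x k"])
      show "(G j has_real_derivative G (Suc j) z) (at z within {y k..y (Suc k)})"
        if "j \<le> q" "z \<in> {y k..y (Suc k)}" for j z
        using der[OF that(1)] that(2) sub DERIV_subset by blast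
      show "norm (G (Suc q) z) \<le> B" if "z \<in> {y k..y (Suc k)}" for z
        using B[of z] that sub by auto
    qed (use ord xy[of k] q h in auto)
    then show ?thesis using xy[of k] by simp
  qed
  have tel: "(\<Sum>k<N. \<Sum>j\<le>q. em_coeff j * h ^ j * (G j (y (Suc k)) - G j (y k)))
     = (\<Sum>j\<le>q. em_coeff j * h ^ j * (G j a - G j (- a)))"
  proof -
    have "(\<Sum>k<N. G j (y (Suc k)) - G j (y k)) = G j a - G j (- a)" for j
      using sum_lessThan_telescope[of "\<lambda>k. G j (y k)" N] h by (simp add: y_def)
    then show ?thesis by (subst sum.swap) (simp add: sum_distrib_left[symmetric])
  qed
  have "punctured_trapezoid a M (G 1) + h * G 1 0 - (\<Sum>j\<le>q. em_coeff j * h ^ j * (G j a - G j (- a)))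
     = (\<Sum>k<N. h * G 1 (x k) - (\<Sum>j\<le>q. em_coeff j * h ^ j * (G j (y (Suc k)) - G j (y k))))"
    unfolding sum_subtractf tel punctured_trapezoid_plus_center[of a M "G 1", folded h_def]
    by (simp only: x_def sum_distrib_left N_def)
  also have "\<bar>\<dots>\<bar> \<le> (\<Sum>k<N. em_const q * B * h ^ Suc q)"
    by (rule order_trans[OF sum_abs sum_mono]) (use cell in auto)
  also have "\<dots> = em_const q * B * h ^ q * (real N * h)"
    by simp
  finally show ?thesis unfolding h(2) by (simp add: mult_ac)
qed

section \<open>Orders of magnitude in the mesh size\<close>

lemma bigo_cmult: "f \<in> O[F](g) \<Longrightarrow> (\<lambda>x. c * f x :: real) \<in> O[F](g)"
  by (cases "c = 0") auto

lemma mesh_power_bigo: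
  assumes "a > 0" "q \<le> j"
  shows "(\<lambda>M. c * mesh a M ^ j) \<in> O(\<lambda>M. mesh a M ^ q)"
proof (rule bigoI[where c = "\<bar>c\<bar> * (2 * a) ^ (j - q)"], rule always_eventually, rule allI)
  fix M
  have "mesh a M ^ j = mesh a M ^ (j - q) * mesh a M ^ q"
    using assms by (simp flip: power_add)
  moreover have "mesh a M ^ (j - q) \<le> (2 * a) ^ (j - q)"
    using assms mesh_le[of a M] mesh_pos[of a M] by (intro power_mono) auto
  ultimately show "norm (c * mesh a M ^ j) \<le> \<bar>c\<bar> * (2 * a) ^ (j - q) * norm (mesh a M ^ q)"
    using mesh_pos[OF assms(1), of M]
    by (simp only: real_norm_def abs_mult abs_of_pos zero_less_power mult.assoc)
       (intro mult_left_mono mult_right_mono, auto)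
qed

lemma punctured_trapezoid_log_bigo:
  assumes a: "a > 0"
  shows "(\<lambda>M. punctured_trapezoid a M (log_tower m (Suc 0))
      - (\<Sum>j\<le>q. em_coeff j * mesh a M ^ j * (log_tower m j a - log_tower m j (- a)))
      - (1 + (-1) ^ m) * mesh a M ^ Suc m * Re (deriv riemann_zeta (- of_nat m))
      - 0 ^ m * mesh a M * ln (mesh a M)) \<in> O(\<lambda>M. mesh a M ^ q)"
proof -
  \<comment> \<open>The order has to grow with \<open>m\<close> to reach the rate h^q. Boundary
    terms of index above \<open>q\<close> are themselves O(h^q), so the truncation at
    \<open>q\<close> can be the same for every \<open>m\<close>.\<close>
  define p where "p = q + m + 2"
  define Z where "Z = Re (deriv riemann_zeta (- of_nat m))"
  define L where "L = (\<lambda>j. log_tower m j a - log_tower m j (- a))"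
  obtain c where c: "\<And>M. M \<ge> 1 \<Longrightarrow> \<bar>zeta_deriv_approx p m M - Z\<bar> \<le> c / real M ^ q"
    using zeta_deriv_approx_error[OF p_def] unfolding Z_def by blast
  have c0: "c \<ge> 0" using c[of 1] by simp
  have eq: "punctured_trapezoid a M (log_tower m (Suc 0)) - (\<Sum>j\<le>q. em_coeff j * mesh a M ^ j * L j)
      - (1 + (-1) ^ m) * mesh a M ^ Suc m * Z - 0 ^ m * mesh a M * ln (mesh a M)
    = (\<Sum>j\<in>{q<..p}. em_coeff j * L j * mesh a M ^ j)
      + (1 + (-1) ^ m) * (mesh a M ^ Suc m * (zeta_deriv_approx p m M - Z))" for M
  proof -
    have "{..p} = {..q} \<union> {q<..p}" by (auto simp: p_def)
    then have "(\<Sum>j\<le>p. em_coeff j * mesh a M ^ j * L j) =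
       (\<Sum>j\<le>q. em_coeff j * mesh a M ^ j * L j) + (\<Sum>j\<in>{q<..p}. em_coeff j * mesh a M ^ j * L j)"
      by (simp add: sum.union_disjoint ivl_disj_int)
    moreover have "punctured_trapezoid a M (log_tower m (Suc 0)) =
        (\<Sum>j\<le>p. em_coeff j * mesh a M ^ j * L j)
       + (1 + (-1) ^ m) * mesh a M ^ Suc m * zeta_deriv_approx p m M + 0 ^ m * mesh a M * ln (mesh a M)"
      unfolding L_def by (rule punctured_trapezoid_log[OF a]) (simp add: p_def)
    ultimately show ?thesis by (simp add: algebra_simps)
  qed
  have "(\<lambda>M. mesh a M ^ Suc m * (zeta_deriv_approx p m M - Z)) \<in> O(\<lambda>M. mesh a M ^ q)"
  proof (rule bigoI[where c = "(2 * a) ^ Suc m * c * (3 / (2 * a)) ^ q"])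
    show "\<forall>\<^sub>F M in sequentially. norm (mesh a M ^ Suc m * (zeta_deriv_approx p m M - Z))
       \<le> (2 * a) ^ Suc m * c * (3 / (2 * a)) ^ q * norm (mesh a M ^ q)"
      using eventually_ge_at_top[of 1]
    proof eventually_elim
      case (elim M)
      have h: "0 < mesh a M" "mesh a M \<le> 2 * a" using a mesh_pos mesh_le by auto
      \<comment> \<open>For M >= 1 one has M + 1/2 <= (3/2) M.\<close>
      have "1 / real M \<le> 3 / (2 * a) * mesh a M"
        using a elim by (simp add: mesh_def field_simps)
      then have "(1 / real M) ^ q \<le> (3 / (2 * a) * mesh a M) ^ q"
        by (intro power_mono) auto
      then have "c / real M ^ q \<le> c * ((3 / (2 * a)) ^ q * mesh a M ^ q)"
        using c0 mult_left_mono by (fastforce simp: power_mult_distrib[symmetric] power_one_over)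
      with c[OF elim] have "\<bar>zeta_deriv_approx p m M - Z\<bar> \<le> c * ((3 / (2 * a)) ^ q * mesh a M ^ q)"
        by linarith
      moreover have "mesh a M ^ Suc m \<le> (2 * a) ^ Suc m" using h by (intro power_mono) auto
      ultimately have "mesh a M ^ Suc m * \<bar>zeta_deriv_approx p m M - Z\<bar>
          \<le> (2 * a) ^ Suc m * (c * ((3 / (2 * a)) ^ q * mesh a M ^ q))"
        using h a by (intro mult_mono) auto
      then show ?case using h by (simp add: abs_mult mult_ac)
    qed
  qed
  then have "(\<lambda>M. (\<Sum>j\<in>{q<..p}. em_coeff j * L j * mesh a M ^ j)
      + (1 + (-1) ^ m) * (mesh a M ^ Suc m * (zeta_deriv_approx p m M - Z))) \<in> O(\<lambda>M. mesh a M ^ q)"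
    by (intro sum_in_bigo(1) big_sum_in_bigo mesh_power_bigo[OF a] bigo_cmult) auto
  then show ?thesis
    unfolding eq[unfolded L_def Z_def] L_def Z_def .
qed

text \<open>The antiderivative \<open>log_tower m 0\<close> is continuous across the singularity, so
  the fundamental theorem applies with 0 as exceptional point.\<close>

lemma integrable_log_tower:
  assumes a: "a > 0"
  shows "set_integrable lborel {- a..a} (log_tower m (Suc 0))"
    and "(LINT x:{- a..a}|lborel. log_tower m (Suc 0) x) = log_tower m 0 a - log_tower m 0 (- a)"
proof -
  have c: "continuous_on UNIV (log_tower m 0)"
  proof -
    have "continuous_on UNIV (\<lambda>x. dzcoeff 0 (- real m) * x ^ Suc m - zcoeff 0 (- real m) * (x ^ Suc m * ln x))"
      by (intro continuous_intros continuous_power_ln) auto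
    moreover have "log_tower m 0 = (\<lambda>x. dzcoeff 0 (- real m) * x ^ Suc m - zcoeff 0 (- real m) * (x ^ Suc m * ln x))"
    proof
      fix x :: real
      have "int m + 1 - int 0 = int (Suc m)" by simp
      then show "log_tower m 0 x = dzcoeff 0 (- real m) * x ^ Suc m - zcoeff 0 (- real m) * (x ^ Suc m * ln x)"
        unfolding log_tower_def by (simp only: power_int_of_nat left_diff_distrib right_diff_distrib mult_ac)
    qed
    ultimately show ?thesis by simp
  qed
  have I: "(log_tower m (Suc 0) has_integral (log_tower m 0 a - log_tower m 0 (- a))) {- a..a}"
  proof (rule fundamental_theorem_of_calculus_interior_strong[where S = "{0}"])
    show "(log_tower m 0 has_vector_derivative log_tower m (Suc 0) x) (at x)" if "x \<in> {- a<..<a} - {0}" for x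
      using has_derivative_log_tower[of x m 0] that by (simp add: has_real_derivative_iff_has_vector_derivative)
  qed (use a c continuous_on_subset in auto)
  have "log_tower m (Suc 0) absolutely_integrable_on {- a..a}"
  proof (cases "m = 0")
    case True
    have c: "(\<lambda>_. \<bar>ln a\<bar>) absolutely_integrable_on {- a..a}"
      by (rule absolutely_integrable_continuous_real) auto
    \<comment> \<open>A gauge integral is absolute for nonnegative integrands, and -ln |x| >= -|ln
      a| on the interval.\<close>
    have "(\<lambda>x. log_tower m (Suc 0) x + \<bar>ln a\<bar>) absolutely_integrable_on {- a..a}"
    proof (rule nonnegative_absolutely_integrable_1)
      show "(\<lambda>x. log_tower m (Suc 0) x + \<bar>ln a\<bar>) integrable_on {- a..a}"
        using I by (intro integrable_add integrable_const_ivl) auto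
      show "0 \<le> log_tower m (Suc 0) x + \<bar>ln a\<bar>" if "x \<in> {- a..a}" for x
      proof (cases "x = 0")
        case False
        have "ln x = ln \<bar>x\<bar>" by (cases "x \<ge> 0") (simp_all only: ln_minus abs_of_nonneg abs_of_neg not_le)
        moreover have "ln \<bar>x\<bar> \<le> ln a" using that False a by (subst ln_le_cancel_iff) auto
        ultimately show ?thesis using True by (simp add: log_tower_1)
      next
        case True
        then show ?thesis by (simp add: log_tower_1)
      qed
    qed
    from set_integral_diff(1)[OF this c] show ?thesis by simp
  next
    case False
    have "continuous_on {- a..a} (\<lambda>x. - (x ^ m * ln x))"
      by (intro continuous_intros continuous_on_subset[OF continuous_power_ln]) (use False in auto)
    then show ?thesis
      by (intro absolutely_integrable_continuous_real) (simp add: log_tower_1[abs_def] mult.commute)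
  qed
  moreover have "log_tower m (Suc 0) \<in> borel_measurable borel"
    unfolding log_tower_1[abs_def] by measurable
  ultimately show "set_integrable lborel {- a..a} (log_tower m (Suc 0))"
    unfolding set_integrable_def by (subst (asm) integrable_completion) auto
  from set_borel_integral_eq_integral(2)[OF this] I
  show "(LINT x:{- a..a}|lborel. log_tower m (Suc 0) x) = log_tower m 0 a - log_tower m 0 (- a)"
    by (simp add: integral_unique)
qed

text \<open>Hadamard's lemma in each coordinate gives \<open>\<rho> x - \<rho> 0\<close> as x times
  a smooth vector, and \<open>u\<close> is the squared length of that vector.\<close>

lemma chord_norm_factor:
  fixes \<rho> :: "real \<Rightarrow> 'a::euclidean_space"
  assumes \<rho>: "\<And>k. cont_diff k UNIV \<rho>"
  obtains u where "\<And>k. cont_diff k UNIV u" "\<And>x. (norm (\<rho> 0 - \<rho> x))\<^sup>2 = x\<^sup>2 * u x" "u 0 = (speed \<rho> 0)\<^sup>2"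
proof -
  have comp: "cont_diff k UNIV (\<lambda>x. \<rho> x \<bullet> b)" for b k
    using \<rho> by (intro cont_diff_inner cont_diff_const)
  have "\<exists>v. (\<forall>k. cont_diff k UNIV v) \<and> (\<forall>x. \<rho> x \<bullet> b = \<rho> 0 \<bullet> b + x * v x)" for b
    using smooth_quotient[OF comp[of _ b]] by metis
  then obtain v where v: "\<And>b k. cont_diff k UNIV (v b)" "\<And>b x. \<rho> x \<bullet> b = \<rho> 0 \<bullet> b + x * v b x"
    by metis
  define u where "u = (\<lambda>x. \<Sum>b\<in>Basis. v b x * v b x)"
  have "cont_diff k UNIV u" for k
  proof -
    have "finite A \<Longrightarrow> cont_diff k UNIV (\<lambda>x. \<Sum>b\<in>A. v b x * v b x)" for A
      by (induction rule: finite_induct) (auto intro!: cont_diff_add cont_diff_mult v)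
    then show ?thesis by (simp add: u_def)
  qed
  moreover have "(norm (\<rho> 0 - \<rho> x))\<^sup>2 = x\<^sup>2 * u x" for x
  proof -
    have "(norm (\<rho> 0 - \<rho> x))\<^sup>2 = (\<Sum>b\<in>Basis. ((\<rho> 0 - \<rho> x) \<bullet> b) * ((\<rho> 0 - \<rho> x) \<bullet> b))"
      unfolding power2_norm_eq_inner by (rule euclidean_inner)
    also have "\<dots> = (\<Sum>b\<in>Basis. x\<^sup>2 * (v b x * v b x))"
      by (rule sum.cong) (auto simp: inner_diff_left v(2)[of x] power2_eq_square)
    finally show ?thesis by (simp add: u_def sum_distrib_left)
  qed
  moreover have "u 0 = (speed \<rho> 0)\<^sup>2"
  proof -
    define d where "d = vector_derivative \<rho> (at 0)"
    have d: "(\<rho> has_vector_derivative d) (at 0)"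
      using \<rho>[of 1] by (auto simp: d_def vector_derivative_works[symmetric] intro: differentiableI_vector)
    have "v b 0 = d \<bullet> b" for b
    proof -
      have "((\<lambda>x. \<rho> x \<bullet> b) has_real_derivative d \<bullet> b) (at 0)"
        unfolding has_real_derivative_iff_has_vector_derivative
        by (rule bounded_linear.has_vector_derivative[OF bounded_linear_inner_left d])
      moreover have "((\<lambda>x. \<rho> 0 \<bullet> b + x * v b x) has_real_derivative 0 + (0 * deriv (v b) 0 + 1 * v b 0)) (at 0)"
        by (rule DERIV_add[OF DERIV_const DERIV_mult'[OF DERIV_ident cont_diff_deriv(1)[OF v(1)]]])
      moreover have "(\<lambda>x. \<rho> x \<bullet> b) = (\<lambda>x. \<rho> 0 \<bullet> b + x * v b x)"
        using v(2) by blast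
      ultimately have "d \<bullet> b = 0 + (0 * deriv (v b) 0 + 1 * v b 0)"
        by (metis DERIV_unique)
      then show ?thesis by simp
    qed
    then have "u 0 = (\<Sum>b\<in>Basis. (d \<bullet> b) * (d \<bullet> b))"
      by (simp add: u_def)
    also have "\<dots> = (speed \<rho> 0)\<^sup>2"
      unfolding speed_def d_def[symmetric] power2_norm_eq_inner by (rule euclidean_inner[symmetric])
    finally show ?thesis .
  qed
  ultimately show thesis by (rule that)
qed

lemma cont_diff_speed:
  fixes \<rho> :: "real \<Rightarrow> 'a::real_inner"
  assumes \<rho>: "\<And>k. cont_diff k UNIV \<rho>" and "\<And>x. vector_derivative \<rho> (at x) \<noteq> 0"
  shows "cont_diff k UNIV (speed \<rho>)"
proof -
  define d where "d = (\<lambda>x. vector_derivative \<rho> (at x))"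
  obtain f' where f': "\<And>x. (\<rho> has_vector_derivative f' x) (at x)" "cont_diff k UNIV f'"
    using \<rho>[of "Suc k"] by auto
  then have "cont_diff k UNIV d"
    using vector_derivative_at by (metis d_def ext)
  then have "cont_diff k UNIV (\<lambda>x. sqrt (d x \<bullet> d x))"
    using assms(2) by (intro cont_diff_sqrt cont_diff_inner) (auto simp: d_def)
  then show ?thesis
    by (simp add: speed_def[abs_def] norm_eq_sqrt_inner d_def)
qed

text \<open>The room beyond [-a, a] is needed twice: for two-sided derivatives at the ends and for
  comparing x with x - 2a.\<close>

lemma regular_closed_curve_simple_at_0:
  assumes "a > 0" "regular_closed_curve a \<rho>" "\<rho> x = \<rho> 0" "- 2 * a < x" "x < 2 * a"
  shows "x = 0"
proof -
  have per: "\<rho> (x + 2 * a) = \<rho> x" for x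
    using assms(2) by (simp add: regular_closed_curve_def periodic_with_def)
  have inj: "x = 0" if "\<rho> x = \<rho> 0" "- a \<le> x" "x < a" for x
    using assms(1,2) that by (auto simp: regular_closed_curve_def dest: inj_onD)
  consider "x < - a" | "- a \<le> x" "x < a" | "x \<ge> a" by linarith
  then show ?thesis
  proof cases
    case 1
    then have "x + 2 * a = 0" using inj[of "x + 2 * a"] per[of x] assms by auto
    then show ?thesis using assms by simp
  next
    case 3
    then have "x - 2 * a = 0" using inj[of "x - 2 * a"] per[of "x - 2 * a"] assms by auto
    then show ?thesis using assms by simp
  qed (use inj assms in auto)
qed

section \<open>The corrected rule\<close>

lemma speed_periodic:
  assumes "regular_closed_curve a \<rho>"
  shows "speed \<rho> (x + 2 * a) = speed \<rho> x"
proof -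
  have per: "\<rho> (x + 2 * a) = \<rho> x" for x
    using assms by (simp add: regular_closed_curve_def periodic_with_def)
  have "\<rho> differentiable at (x + 2 * a)"
    using assms unfolding regular_closed_curve_def smooth_def by (metis funpow_0 nth_vderiv_def)
  then have "(\<rho> has_vector_derivative vector_derivative \<rho> (at (x + 2 * a))) (at (x + 2 * a))"
    by (simp add: vector_derivative_works)
  moreover have "((\<lambda>x. x + 2 * a) has_vector_derivative 1) (at x)"
    by (auto intro!: derivative_eq_intros)
  ultimately have "(\<rho> \<circ> (\<lambda>x. x + 2 * a) has_vector_derivative 1 *\<^sub>R vector_derivative \<rho> (at (x + 2 * a))) (at x)"
    by (intro vector_diff_chain_at)
  then have "(\<rho> has_vector_derivative vector_derivative \<rho> (at (x + 2 * a))) (at x)"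
    by (simp add: per o_def)
  then show ?thesis
    by (simp add: speed_def vector_derivative_at)
qed

text \<open>The functions are controlled only on (-p, p) off 0, so periodicity is replaced by a
  comparison of the two halves. For p = 2a and x = a it equates the values at \<open>a\<close> and
  \<open>- a\<close>.\<close>

lemma derivative_tower_periodic:
  fixes V :: "nat \<Rightarrow> real \<Rightarrow> real"
  assumes der: "\<And>i x. i < q \<Longrightarrow> x \<in> {- p<..<p} - {0} \<Longrightarrow> (V i has_real_derivative V (Suc i) x) (at x)"
    and per: "\<And>x. x \<in> {0<..<p} \<Longrightarrow> V 0 x = V 0 (x - p)"
  shows "i \<le> q \<Longrightarrow> x \<in> {0<..<p} \<Longrightarrow> V i x = V i (x - p)"
proof (induction i arbitrary: x)
  case (Suc i)
  have "((\<lambda>x. V i (x - p)) has_real_derivative V (Suc i) (x - p) * 1) (at x)"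
    by (rule DERIV_chain2[OF der]) (use Suc.prems in \<open>auto intro!: derivative_eq_intros\<close>)
  then have "((\<lambda>x. V i (x - p)) has_real_derivative V (Suc i) (x - p)) (at x)"
    by simp
  then have "(V i has_real_derivative V (Suc i) (x - p)) (at x)"
    by (rule has_field_derivative_transform_within_open[where S = "{0<..<p}"])
       (use Suc in auto)
  moreover have "(V i has_real_derivative V (Suc i) x) (at x)"
    using Suc.prems by (intro der) auto
  ultimately show ?case by (rule DERIV_unique[symmetric])
qed (use per in auto)

text \<open>The split destroys periodicity, since powers of x are not periodic; only the sum of both
  parts inherits it, and so the boundary identity concerns the sum. Index 0 is left out of it
  because that difference is the integral.\<close>

lemma layer_density_decomposition:
  fixes \<rho> :: "real \<Rightarrow> 'a::euclidean_space"
  assumes a: "a > 0" and \<rho>: "regular_closed_curve a \<rho>"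
    and \<phi>: "\<And>k. cont_diff k UNIV \<phi>" and per: "\<And>x. \<phi> (x + 2 * a) = \<phi> x"
  obtains \<alpha> \<psi> G where
    "\<And>k. cont_diff k UNIV \<psi>"
    "\<And>x. \<phi> x = (\<Sum>m\<le>q. \<alpha> m * x ^ m) + x ^ Suc q * \<psi> x"
    "\<And>j x. j \<le> q \<Longrightarrow> x \<in> {- a..a} \<Longrightarrow> (G j has_real_derivative G (Suc j) x) (at x within {- a..a})"
    "continuous_on {- a..a} (G (Suc q))"
    "\<And>x. x \<noteq> 0 \<Longrightarrow> x \<in> {- a..a} \<Longrightarrow>
       - ln (norm (\<rho> 0 - \<rho> x)) * \<phi> x = (\<Sum>m\<le>q. \<alpha> m * log_tower m (Suc 0) x) + G (Suc 0) x"
    "G (Suc 0) 0 = - ln (speed \<rho> 0) * \<phi> 0"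
    "\<And>j. j \<in> {1..q} \<Longrightarrow>
       (\<Sum>m\<le>q. \<alpha> m * (log_tower m j a - log_tower m j (- a))) + (G j a - G j (- a)) = 0"
proof -
  define S where "S = {- 2 * a<..<2 * a}"
  have sm: "cont_diff k UNIV \<rho>" for k
    using \<rho> by (intro smooth_imp_cont_diff) (simp add: regular_closed_curve_def)
  have per\<rho>: "\<rho> (x + 2 * a) = \<rho> x" for x
    using \<rho> by (simp add: regular_closed_curve_def periodic_with_def)
  have sp: "speed \<rho> 0 > 0"
    using \<rho> by (simp add: regular_closed_curve_def speed_def)
  obtain u where u: "\<And>k. cont_diff k UNIV u" "\<And>x. (norm (\<rho> 0 - \<rho> x))\<^sup>2 = x\<^sup>2 * u x" "u 0 = (speed \<rho> 0)\<^sup>2"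
    using chord_norm_factor[OF sm] by blast
  have u_nz: "u x \<noteq> 0" if "x \<in> S" for x
  proof (cases "x = 0")
    case False
    then have "\<rho> x \<noteq> \<rho> 0" using regular_closed_curve_simple_at_0[OF a \<rho>, of x] that by (auto simp: S_def)
    then have "(norm (\<rho> 0 - \<rho> x))\<^sup>2 \<noteq> 0" by simp
    then show ?thesis unfolding u(2) by auto
  qed (use u(3) sp in auto)
  obtain \<alpha> \<psi> where \<psi>: "\<And>k. cont_diff k UNIV \<psi>" "\<And>x. \<phi> x = (\<Sum>m<Suc q. \<alpha> m * x ^ m) + x ^ Suc q * \<psi> x"
    using smooth_taylor[OF \<phi>, of "Suc q"] by blast
  \<comment> \<open>Two leftovers: ln u, halved because \<open>u\<close> belongs to the squared
    distance, and the Taylor remainder of the density times -ln |x|. The latter limits the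
    regularity to \<open>q\<close>.\<close>
  define R where "R = (\<lambda>x. (-1/2) * (ln (u x) * \<phi> x) + (-1) * ((x ^ Suc q * ln x) * \<psi> x))"
  define f where "f = (\<lambda>x. - ln (norm (\<rho> 0 - \<rho> x)) * \<phi> x)"
  have f_eq: "f x = (\<Sum>m\<le>q. \<alpha> m * log_tower m (Suc 0) x) + R x" if "x \<in> S" "x \<noteq> 0" for x
  proof -
    define N where "N = norm (\<rho> 0 - \<rho> x)"
    have "N * N = x * x * u x" using u(2)[of x] by (simp add: N_def power2_eq_square)
    moreover have "x * x * u x \<noteq> 0" using u_nz that by simp
    \<comment> \<open>Doubling avoids square roots, and as \<open>ln\<close> is even the factor
      \<open>x\<close> may be negative.\<close>
    ultimately have "ln N + ln N = ln x + ln x + ln (u x)"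
      by (metis ln_mult mult_eq_0_iff)
    then have "ln N = ln x + ln (u x) / 2" by simp
    then have "f x = - ln x * \<phi> x + (-1/2) * (ln (u x) * \<phi> x)"
      by (simp add: f_def N_def algebra_simps)
    also have "- ln x * \<phi> x = (\<Sum>m\<le>q. \<alpha> m * log_tower m (Suc 0) x) + (-1) * ((x ^ Suc q * ln x) * \<psi> x)"
      unfolding \<psi>(2)[of x] by (simp add: log_tower_1 algebra_simps sum_distrib_left lessThan_Suc_atMost[symmetric] sum_negf del: sum.lessThan_Suc)
    finally show ?thesis by (simp add: R_def)
  qed
  have "cont_diff q S R"
    unfolding R_def
    by (intro cont_diff_add cont_diff_mult cont_diff_const cont_diff_ln u_nz
        cont_diff_subset[OF cont_diff_power_ln] cont_diff_subset[OF u(1)]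
        cont_diff_subset[OF \<phi>] cont_diff_subset[OF \<psi>(1)]) auto
  from cont_diff_tower[OF this] obtain D where D: "D 0 = R"
    "\<And>j x. j < q \<Longrightarrow> x \<in> S \<Longrightarrow> (D j has_real_derivative D (Suc j) x) (at x)" "continuous_on S (D q)"
    by blast
  have sub: "{- a..a} \<subseteq> S" using a by (auto simp: S_def)
  have "continuous_on {- a..a} R"
    using \<open>cont_diff q S R\<close> sub cont_diff_imp_continuous_on continuous_on_subset by blast
  then obtain A where A: "\<And>x. x \<in> {- a..a} \<Longrightarrow> (A has_vector_derivative R x) (at x within {- a..a})"
    by (rule antiderivative_continuous) blast
  \<comment> \<open>Shifted so that index 1 is \<open>R\<close> and index 0 its
    antiderivative.\<close>
  define G where "G = (\<lambda>j. case j of 0 \<Rightarrow> A | Suc i \<Rightarrow> D i)"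
  have G_der: "(G j has_real_derivative G (Suc j) x) (at x within {- a..a})" if "j \<le> q" "x \<in> {- a..a}" for j x
  proof (cases j)
    case 0
    then show ?thesis using A[OF that(2)] by (simp add: G_def D(1) has_real_derivative_iff_has_vector_derivative)
  next
    case (Suc i)
    then have "(D i has_real_derivative D (Suc i) x) (at x)"
      using D(2)[of i x] that sub by auto
    then show ?thesis
      unfolding G_def Suc by (simp only: nat.case) (rule has_field_derivative_at_within)
  qed
  define V where "V = (\<lambda>i x. (\<Sum>m\<le>q. \<alpha> m * log_tower m (Suc i) x) + D i x)"
  have bdry: "V i a = V i (- a)" if "i < q" for i
  proof -
    have "V i a = V i (a - 2 * a)"
    proof (rule derivative_tower_periodic[of q "2 * a" V i a])
      show "(V i has_real_derivative V (Suc i) x) (at x)" if "i < q" "x \<in> {- (2 * a)<..<2 * a} - {0}" for i x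
        unfolding V_def using that
        by (intro DERIV_add DERIV_sum DERIV_cmult has_derivative_log_tower D(2)) (auto simp: S_def)
      show "V 0 x = V 0 (x - 2 * a)" if "x \<in> {0<..<2 * a}" for x
      proof -
        have "f x = f (x - 2 * a)"
          using per[of "x - 2 * a"] per\<rho>[of "x - 2 * a"] by (simp add: f_def)
        then show ?thesis
          using f_eq[of x] f_eq[of "x - 2 * a"] that by (simp add: V_def D(1) S_def)
      qed
    qed (use a that in auto)
    then show ?thesis by simp
  qed
  show thesis
  proof (rule that[of \<psi> \<alpha> G])
    show "\<phi> x = (\<Sum>m\<le>q. \<alpha> m * x ^ m) + x ^ Suc q * \<psi> x" for x
      using \<psi>(2)[of x] by (simp only: lessThan_Suc_atMost)
    show "continuous_on {- a..a} (G (Suc q))"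
      using D(3) sub continuous_on_subset by (auto simp: G_def)
    show "- ln (norm (\<rho> 0 - \<rho> x)) * \<phi> x = (\<Sum>m\<le>q. \<alpha> m * log_tower m (Suc 0) x) + G (Suc 0) x"
      if "x \<noteq> 0" "x \<in> {- a..a}" for x
      using f_eq[of x] that sub by (auto simp: f_def G_def D(1))
    show "G (Suc 0) 0 = - ln (speed \<rho> 0) * \<phi> 0"
      using sp by (simp add: G_def D(1) R_def u(3) ln_realpow)
    show "(\<Sum>m\<le>q. \<alpha> m * (log_tower m j a - log_tower m j (- a))) + (G j a - G j (- a)) = 0"
      if "j \<in> {1..q}" for j
    proof (cases j)
      case (Suc i)
      then show ?thesis
        using bdry[of i] that by (simp add: V_def G_def right_diff_distrib sum_subtractf)
    qed (use that in simp)
  qed (use \<psi>(1) G_der in auto)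
qed

lemma tendsto_mesh: "mesh a \<longlonglongrightarrow> 0"
proof -
  have "filterlim (\<lambda>M. real M + 1/2) at_top sequentially"
    by (rule filterlim_at_top_mono[OF filterlim_real_sequentially]) auto
  then show ?thesis
    unfolding mesh_def[abs_def]
    by (intro tendsto_divide_0[OF tendsto_const] filterlim_at_top_imp_at_infinity)
qed

theorem theorem5:
  fixes a :: real and \<rho> :: "real \<Rightarrow> real ^ 'n" and \<tau> :: "real \<Rightarrow> real"
    and K :: nat and w :: "nat \<Rightarrow> real"
  assumes "a > 0"
    and "regular_closed_curve a \<rho>"
    and "smooth \<tau>" and "periodic_with (2 * a) \<tau>"
    and "\<And>k. k \<le> K \<Longrightarrow>
      complex_of_real (\<Sum>j=0..K. w j * real j ^ (2 * k)) = - deriv riemann_zeta (- 2 * of_nat k)"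
  shows "let s = (\<lambda>x. - ln (norm (\<rho> 0 - \<rho> x)));
             \<tau>' = (\<lambda>x. \<tau> x * speed \<rho> x);
             h = mesh a
         in smooth \<tau>' \<and>
            (\<lambda>M. single_layer a \<rho> \<tau> (\<rho> 0) -
                 (punctured_trapezoid a M (\<lambda>x. s x * \<tau>' x)
                  - \<tau>' 0 * h M * ln (speed \<rho> 0 * h M)
                  + h M * (\<Sum>j=0..K. w j * (\<tau>' (real j * h M) + \<tau>' (- real j * h M)))))
            \<in> O(\<lambda>M. h M ^ (2 * K + 2))"
proof -
  note a = assms(1) and \<rho> = assms(2)
  define q where "q = 2 * K + 2"
  define h where "h = mesh a"
  define \<phi> where "\<phi> = (\<lambda>x. \<tau> x * speed \<rho> x)"
  define f where "f = (\<lambda>x. - ln (norm (\<rho> 0 - \<rho> x)) * \<phi> x)"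
  have sm\<rho>: "cont_diff k UNIV \<rho>" for k
    using \<rho> by (intro smooth_imp_cont_diff) (simp add: regular_closed_curve_def)
  have sp: "speed \<rho> 0 > 0"
    using \<rho> by (simp add: regular_closed_curve_def speed_def)
  have \<phi>: "cont_diff k UNIV \<phi>" for k
    unfolding \<phi>_def using \<rho>
    by (intro cont_diff_mult cont_diff_speed sm\<rho> smooth_imp_cont_diff assms) (simp add: regular_closed_curve_def)
  have per: "\<phi> (x + 2 * a) = \<phi> x" for x
    using assms(4) speed_periodic[OF \<rho>, of x] by (simp add: \<phi>_def periodic_with_def)
  have h: "h M > 0" for M
    unfolding h_def using a by (rule mesh_pos)
  obtain \<alpha> \<psi> G where
    \<psi>: "\<And>k. cont_diff k UNIV \<psi>" "\<And>x. \<phi> x = (\<Sum>m\<le>q. \<alpha> m * x ^ m) + x ^ Suc q * \<psi> x" and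
    G: "\<And>j x. j \<le> q \<Longrightarrow> x \<in> {- a..a} \<Longrightarrow> (G j has_real_derivative G (Suc j) x) (at x within {- a..a})"
      "continuous_on {- a..a} (G (Suc q))" and
    eq: "\<And>x. x \<noteq> 0 \<Longrightarrow> x \<in> {- a..a} \<Longrightarrow>
        - ln (norm (\<rho> 0 - \<rho> x)) * \<phi> x = (\<Sum>m\<le>q. \<alpha> m * log_tower m (Suc 0) x) + G (Suc 0) x" and
    G0: "G (Suc 0) 0 = - ln (speed \<rho> 0) * \<phi> 0" and
    bdry: "\<And>j. j \<in> {1..q} \<Longrightarrow>
       (\<Sum>m\<le>q. \<alpha> m * (log_tower m j a - log_tower m j (- a))) + (G j a - G j (- a)) = 0"
    by (rule layer_density_decomposition[OF a \<rho> \<phi> per, of q]) (rule that)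
  have f_eq: "f x = (\<Sum>m\<le>q. \<alpha> m * log_tower m (Suc 0) x) + G (Suc 0) x" if "x \<noteq> 0" "x \<in> {- a..a}" for x
    using eq[OF that] by (simp only: f_def)
  define L where "L = (\<lambda>m j. log_tower m j a - log_tower m j (- a))"
  define Z where "Z = (\<lambda>m. Re (deriv riemann_zeta (- of_nat m)))"
  define W where "W = (\<lambda>m. \<Sum>j=0..K. w j * real j ^ m)"
  have ZW: "Z (2 * k) + W (2 * k) = 0" if "k \<le> K" for k
  proof -
    have "- 2 * of_nat k = (- of_nat (2 * k) :: complex)" by simp
    then have "complex_of_real (W (2 * k)) = - deriv riemann_zeta (- of_nat (2 * k))"
      using assms(5)[OF that] unfolding W_def by (simp only:)
    then have "Re (complex_of_real (W (2 * k))) = - Z (2 * k)"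
      unfolding Z_def by (simp only: uminus_complex.sel)
    then show ?thesis by simp
  qed

  \<comment> \<open>At index 0 the towers are antiderivatives, so the integral is the boundary term
    j = 0.\<close>
  have layer: "single_layer a \<rho> \<tau> (\<rho> 0) = (\<Sum>m\<le>q. \<alpha> m * L m 0) + (G 0 a - G 0 (- a))"
  proof -
    have cG: "continuous_on {- a..a} (G (Suc 0))"
    proof -
      have "continuous_on {- a..a} (G j)" if "j \<le> q" for j
        using G(1)[OF that] by (rule DERIV_continuous_on)
      then show ?thesis by (simp add: q_def)
    qed
    have iG: "set_integrable lborel {- a..a} (G (Suc 0))"
      by (rule borel_integrable_atLeastAtMost'[OF cG])
    have "(G (Suc 0) has_integral (G 0 a - G 0 (- a))) {- a..a}"
      using a G(1)[of 0] by (intro fundamental_theorem_of_calculus) (auto simp: has_real_derivative_iff_has_vector_derivative)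
    then have vG: "(LINT x:{- a..a}|lborel. G (Suc 0) x) = G 0 a - G 0 (- a)"
      using set_borel_integral_eq_integral(2)[OF iG] by (simp add: integral_unique)
    have i\<alpha>: "set_integrable lborel {- a..a} (\<lambda>x. \<alpha> m * log_tower m (Suc 0) x)" for m
      by (rule set_integrable_mult_right) (rule integrable_log_tower(1)[OF a])
    have iS: "set_integrable lborel {- a..a} (\<lambda>x. \<Sum>m\<le>q. \<alpha> m * log_tower m (Suc 0) x)"
      using i\<alpha> unfolding set_integrable_def scaleR_sum_right by (intro Bochner_Integration.integrable_sum)
    have "single_layer a \<rho> \<tau> (\<rho> 0) = (LINT x:{- a..a}|lborel. f x)"
      by (simp add: single_layer_def f_def \<phi>_def mult.assoc)
    also have "\<dots> = (LINT x:{- a..a}|lborel. (\<Sum>m\<le>q. \<alpha> m * log_tower m (Suc 0) x) + G (Suc 0) x)"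
    proof -
      \<comment> \<open>The two integrands may differ at 0: \<open>f 0 = 0\<close> by the convention
        \<open>ln 0 = 0\<close>, whereas \<open>G (Suc 0) 0\<close> carries the logarithm of the
        speed.\<close>
      have "AE x in lborel. x \<noteq> (0::real)"
        by (rule AE_lborel_singleton)
      then have "AE x in lborel. indicator {- a..a} x *\<^sub>R f x =
          indicator {- a..a} x *\<^sub>R ((\<Sum>m\<le>q. \<alpha> m * log_tower m (Suc 0) x) + G (Suc 0) x)"
        by eventually_elim (auto simp: f_eq indicator_def)
      moreover have "(\<lambda>x. indicator {- a..a} x *\<^sub>R f x) \<in> borel_measurable lborel"
      proof -
        have "\<rho> \<in> borel_measurable borel" "\<phi> \<in> borel_measurable borel"
          using cont_diff_imp_continuous_on[OF sm\<rho>] cont_diff_imp_continuous_on[OF \<phi>]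
          by (auto intro: borel_measurable_continuous_onI)
        then show ?thesis unfolding f_def by measurable
      qed
      moreover have "(\<lambda>x. indicator {- a..a} x *\<^sub>R ((\<Sum>m\<le>q. \<alpha> m * log_tower m (Suc 0) x) + G (Suc 0) x)) \<in> borel_measurable lborel"
        using set_integral_add(1)[OF iS iG] unfolding set_integrable_def by (rule borel_measurable_integrable)
      ultimately show ?thesis
        unfolding set_lebesgue_integral_def by (intro integral_cong_AE)
    qed
    also have "\<dots> = (LINT x:{- a..a}|lborel. \<Sum>m\<le>q. \<alpha> m * log_tower m (Suc 0) x) + (G 0 a - G 0 (- a))"
      unfolding set_integral_add(2)[OF iS iG] vG ..
    also have "(LINT x:{- a..a}|lborel. \<Sum>m\<le>q. \<alpha> m * log_tower m (Suc 0) x) = (\<Sum>m\<le>q. \<alpha> m * L m 0)"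
    proof -
      have "(LINT x:{- a..a}|lborel. \<Sum>m\<le>q. \<alpha> m * log_tower m (Suc 0) x)
         = (\<Sum>m\<le>q. LINT x:{- a..a}|lborel. \<alpha> m * log_tower m (Suc 0) x)"
        using i\<alpha> unfolding set_lebesgue_integral_def set_integrable_def scaleR_sum_right
        by (intro Bochner_Integration.integral_sum)
      also have "\<dots> = (\<Sum>m\<le>q. \<alpha> m * L m 0)"
        by (simp only: set_integral_mult_right integrable_log_tower(2)[OF a] L_def)
      finally show ?thesis .
    qed
    finally show ?thesis .
  qed

  define eL where "eL = (\<lambda>m M. punctured_trapezoid a M (log_tower m (Suc 0))
      - (\<Sum>j\<le>q. em_coeff j * h M ^ j * L m j)
      - (1 + (-1) ^ m) * h M ^ Suc m * Z m - 0 ^ m * h M * ln (h M))"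
  have eL: "eL m \<in> O(\<lambda>M. h M ^ q)" for m
    unfolding eL_def h_def L_def Z_def by (rule punctured_trapezoid_log_bigo[OF a])
  define eG where "eG = (\<lambda>M. punctured_trapezoid a M (G (Suc 0)) + h M * G (Suc 0) 0
      - (\<Sum>j\<le>q. em_coeff j * h M ^ j * (G j a - G j (- a))))"
  have eG: "eG \<in> O(\<lambda>M. h M ^ q)"
  proof -
    have "\<exists>B. \<forall>x\<in>{- a..a}. \<bar>G (Suc q) x\<bar> \<le> B"
      using compact_imp_bounded[OF compact_continuous_image[OF G(2) compact_Icc]]
      by (simp add: bounded_iff)
    then obtain B where B: "\<And>x. x \<in> {- a..a} \<Longrightarrow> \<bar>G (Suc q) x\<bar> \<le> B"
      by blast
    have "\<bar>eG M\<bar> \<le> em_const q * B * (2 * a) * h M ^ q" for M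
      using punctured_trapezoid_smooth[of a q G B M, OF a _ G(1) B] unfolding eG_def h_def by (simp add: q_def)
    then show ?thesis
      using h by (intro bigoI[where c = "em_const q * B * (2 * a)"]) (auto simp: less_imp_le)
  qed
  \<comment> \<open>The Taylor remainder of the density at the correction nodes, with h^(q+1) taken
    out; it stays bounded because the nodes tend to 0.\<close>
  define e\<psi> where "e\<psi> = (\<lambda>M. \<Sum>j=0..K. w j * (real j ^ Suc q * (\<psi> (real j * h M) + (-1) ^ Suc q * \<psi> (- real j * h M))))"
  have e\<psi>: "(\<lambda>M. h M * (h M ^ Suc q * e\<psi> M)) \<in> O(\<lambda>M. h M ^ q)"
  proof -
    have c: "isCont \<psi> 0"
      using cont_diff_imp_continuous_on[OF \<psi>(1)] continuous_on_eq_continuous_at[of UNIV \<psi>] by blast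
    have lim: "(\<lambda>M. \<psi> (c * h M)) \<longlonglongrightarrow> \<psi> 0" for c
      by (rule isCont_tendsto_compose[OF c]) (use tendsto_mult[OF tendsto_const[of c] tendsto_mesh[of a]] in \<open>simp add: h_def\<close>)
    have "e\<psi> \<longlonglongrightarrow> (\<Sum>j=0..K. w j * (real j ^ Suc q * (\<psi> 0 + (-1) ^ Suc q * \<psi> 0)))"
      unfolding e\<psi>_def by (intro tendsto_intros lim)
    then have "e\<psi> \<in> O(\<lambda>_. 1)"
      by (intro bigoI_tendsto[where c = "(\<Sum>j=0..K. w j * (real j ^ Suc q * (\<psi> 0 + (-1) ^ Suc q * \<psi> 0)))"]) simp_all
    moreover have "(\<lambda>M. 1 * h M ^ Suc (Suc q)) \<in> O(\<lambda>M. h M ^ q)"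
      unfolding h_def by (rule mesh_power_bigo[OF a]) simp
    ultimately have "(\<lambda>M. (1 * h M ^ Suc (Suc q)) * e\<psi> M) \<in> O(\<lambda>M. h M ^ q * 1)"
      by (intro landau_o.big.mult)
    then show ?thesis by (simp add: mult_ac)
  qed

  have trap: "punctured_trapezoid a M f = (\<Sum>m\<le>q. \<alpha> m * punctured_trapezoid a M (log_tower m (Suc 0)))
      + punctured_trapezoid a M (G (Suc 0))" for M
  proof -
    have "f (of_int n * h M) = (\<Sum>m\<le>q. \<alpha> m * log_tower m (Suc 0) (of_int n * h M)) + G (Suc 0) (of_int n * h M)"
      if "n \<in> {- int M..int M} - {0}" for n
    proof (rule f_eq)
      have "\<bar>of_int n\<bar> * h M \<le> (real M + 1/2) * h M"
        using that h[of M] by (intro mult_right_mono) auto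
      also have "\<dots> = a" by (simp add: h_def mesh_def)
      finally have "\<bar>of_int n * h M\<bar> \<le> a" using h[of M] by (simp add: abs_mult)
      then show "of_int n * h M \<in> {- a..a}" by auto
    qed (use that h[of M] in auto)
    then show ?thesis
      unfolding punctured_trapezoid_def h_def[symmetric]
      by (simp add: distrib_right sum.distrib sum_distrib_left sum_distrib_right mult.assoc)
         (rule sum.swap)
  qed

  \<comment> \<open>The Taylor identity holds on the whole line, so nodes beyond \<open>a\<close>,
    which can occur on a coarse mesh, are covered.\<close>
  have corr: "(\<Sum>j=0..K. w j * (\<phi> (real j * h M) + \<phi> (- real j * h M)))
      = (\<Sum>m\<le>q. \<alpha> m * (1 + (-1) ^ m) * h M ^ m * W m) + h M ^ Suc q * e\<psi> M" for M
  proof -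
    have "\<phi> (real j * h M) + \<phi> (- real j * h M) =
       (\<Sum>m\<le>q. \<alpha> m * (1 + (-1) ^ m) * h M ^ m * real j ^ m)
        + h M ^ Suc q * (real j ^ Suc q * (\<psi> (real j * h M) + (-1) ^ Suc q * \<psi> (- real j * h M)))" for j
    proof -
      define x where "x = real j * h M"
      have x: "- real j * h M = - x" "x ^ m = h M ^ m * real j ^ m" "(- x) ^ m = (-1) ^ m * x ^ m" for m
        by (simp_all add: x_def power_mult_distrib power_minus[of "real j * h M"])
      have "\<phi> x + \<phi> (- x) = ((\<Sum>m\<le>q. \<alpha> m * x ^ m) + (\<Sum>m\<le>q. \<alpha> m * ((-1) ^ m * x ^ m)))
         + x ^ Suc q * (\<psi> x + (-1) ^ Suc q * \<psi> (- x))"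
        unfolding \<psi>(2)[of x] \<psi>(2)[of "- x"] x(3) by (simp only: distrib_left mult_ac add_ac)
      also have "(\<Sum>m\<le>q. \<alpha> m * x ^ m) + (\<Sum>m\<le>q. \<alpha> m * ((-1) ^ m * x ^ m))
         = (\<Sum>m\<le>q. \<alpha> m * (1 + (-1) ^ m) * x ^ m)"
        unfolding sum.distrib[symmetric] by (rule sum.cong) (auto simp: algebra_simps)
      finally show ?thesis
        unfolding x(1) x_def[symmetric] unfolding x(2) by (simp only: mult.assoc)
    qed
    then show ?thesis
      unfolding W_def e\<psi>_def
      by (simp only: distrib_left sum.distrib sum_distrib_left)
         (subst sum.swap, simp only: mult_ac)
  qed

  have cancel: "(\<Sum>m\<le>q. \<alpha> m * (\<Sum>j\<le>q. em_coeff j * h M ^ j * L m j))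
      + (\<Sum>j\<le>q. em_coeff j * h M ^ j * (G j a - G j (- a))) = single_layer a \<rho> \<tau> (\<rho> 0)" for M
  proof -
    have "(\<Sum>m\<le>q. \<alpha> m * (\<Sum>j\<le>q. em_coeff j * h M ^ j * L m j))
        = (\<Sum>j\<le>q. em_coeff j * h M ^ j * (\<Sum>m\<le>q. \<alpha> m * L m j))"
      unfolding sum_distrib_left by (subst sum.swap) (simp only: mult_ac)
    then have "(\<Sum>m\<le>q. \<alpha> m * (\<Sum>j\<le>q. em_coeff j * h M ^ j * L m j))
      + (\<Sum>j\<le>q. em_coeff j * h M ^ j * (G j a - G j (- a)))
      = (\<Sum>j\<le>q. em_coeff j * h M ^ j * ((\<Sum>m\<le>q. \<alpha> m * L m j) + (G j a - G j (- a))))"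
      by (simp only: distrib_left sum.distrib)
    \<comment> \<open>Periodicity removes the indices from 1 to \<open>q\<close>; at 0 the
      coefficient \<open>em_coeff 0\<close> is 1.\<close>
    also have "\<dots> = (\<Sum>j\<in>{0}. em_coeff j * h M ^ j * ((\<Sum>m\<le>q. \<alpha> m * L m j) + (G j a - G j (- a))))"
    proof (rule sum.mono_neutral_right)
      show "\<forall>j\<in>{..q} - {0}. em_coeff j * h M ^ j * ((\<Sum>m\<le>q. \<alpha> m * L m j) + (G j a - G j (- a))) = 0"
        using bdry by (auto simp: L_def)
    qed auto
    finally show ?thesis by (simp add: layer)
  qed

  have \<alpha>0: "\<alpha> 0 = \<phi> 0"
    using \<psi>(2)[of 0] by (simp add: power_0_left sum.delta' if_distrib[of "(*) _"] cong: if_cong)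
  have key: "single_layer a \<rho> \<tau> (\<rho> 0) -
        (punctured_trapezoid a M f - \<phi> 0 * h M * ln (speed \<rho> 0 * h M)
          + h M * (\<Sum>j=0..K. w j * (\<phi> (real j * h M) + \<phi> (- real j * h M))))
     = - (\<Sum>m\<le>q. \<alpha> m * eL m M) - eG M
       - (\<Sum>m\<le>q. \<alpha> m * (1 + (-1) ^ m) * (Z m + W m) * h M ^ Suc m) - h M * (h M ^ Suc q * e\<psi> M)" for M
  proof -
    have "(\<Sum>m\<le>q. \<alpha> m * punctured_trapezoid a M (log_tower m (Suc 0)))
        = (\<Sum>m\<le>q. \<alpha> m * eL m M) + (\<Sum>m\<le>q. \<alpha> m * (\<Sum>j\<le>q. em_coeff j * h M ^ j * L m j))
          + (\<Sum>m\<le>q. \<alpha> m * (1 + (-1) ^ m) * Z m * h M ^ Suc m) + (\<Sum>m\<le>q. \<alpha> m * (0 ^ m * h M * ln (h M)))"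
      unfolding sum.distrib[symmetric] by (rule sum.cong) (auto simp: eL_def algebra_simps)
    moreover have "(\<Sum>m\<le>q. \<alpha> m * (0 ^ m * h M * ln (h M))) = \<phi> 0 * h M * ln (h M)"
    proof -
      have "(\<Sum>m\<le>q. \<alpha> m * (0 ^ m * h M * ln (h M))) = (\<Sum>m\<in>{0}. \<alpha> m * (0 ^ m * h M * ln (h M)))"
        by (rule sum.mono_neutral_right) auto
      then show ?thesis by (simp add: \<alpha>0)
    qed
    \<comment> \<open>The omitted centre value puts the speed into the logarithm of the
      rule.\<close>
    moreover have "punctured_trapezoid a M (G (Suc 0)) = eG M + h M * ln (speed \<rho> 0) * \<phi> 0
       + (\<Sum>j\<le>q. em_coeff j * h M ^ j * (G j a - G j (- a)))"
      by (simp add: eG_def G0)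
    moreover have "ln (speed \<rho> 0 * h M) = ln (speed \<rho> 0) + ln (h M)"
      using sp h[of M] by (simp add: ln_mult)
    moreover have "h M * (\<Sum>m\<le>q. \<alpha> m * (1 + (-1) ^ m) * h M ^ m * W m) + (\<Sum>m\<le>q. \<alpha> m * (1 + (-1) ^ m) * Z m * h M ^ Suc m)
       = (\<Sum>m\<le>q. \<alpha> m * (1 + (-1) ^ m) * (Z m + W m) * h M ^ Suc m)"
      unfolding sum_distrib_left sum.distrib[symmetric] by (rule sum.cong) (auto simp: algebra_simps)
    ultimately show ?thesis
      using cancel[of M] unfolding trap corr by (simp add: algebra_simps)
  qed
  \<comment> \<open>Odd \<open>m\<close> vanish by symmetry, even m <= 2K by the weights. Only m = q
    remains, where h^(q+1) is small enough.\<close>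
  have moments: "(\<lambda>M. \<alpha> m * (1 + (-1) ^ m) * (Z m + W m) * h M ^ Suc m) \<in> O(\<lambda>M. h M ^ q)" if "m \<le> q" for m
  proof (cases "even m \<and> m < q")
    case True
    then obtain k where "m = 2 * k" "k \<le> K" by (auto simp: q_def elim!: evenE)
    then show ?thesis using ZW[of k] by simp
  next
    case False
    then show ?thesis
    proof (cases "even m")
      case True
      with False that show ?thesis
        unfolding h_def by (intro mesh_power_bigo[OF a]) auto
    qed simp
  qed
  have "(\<lambda>M. single_layer a \<rho> \<tau> (\<rho> 0) -
        (punctured_trapezoid a M f - \<phi> 0 * h M * ln (speed \<rho> 0 * h M)
          + h M * (\<Sum>j=0..K. w j * (\<phi> (real j * h M) + \<phi> (- real j * h M))))) \<in> O(\<lambda>M. h M ^ q)"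
    unfolding key
    by (intro sum_in_bigo(2) big_sum_in_bigo bigo_cmult eL eG e\<psi> moments iffD2[OF landau_o.big.uminus_in_iff]) auto
  moreover have "smooth \<phi>"
    by (rule cont_diff_imp_smooth) (rule \<phi>)
  ultimately show ?thesis
    unfolding Let_def q_def h_def f_def \<phi>_def by blast
qed

end
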